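(* Let $\mathcal H$ be finite-dimensional, let $\mathcal T$ be a convex set of states on $\mathcal H$, and let $\mathcal A$ be a convex set of effects on $\mathcal H$ containing $I$ and closed under $E\mapsto I-E$. Then the subtheory $(\mathcal T,\mathcal A)$ is measurement and preparation non-contextual if and only if $(\mathcal T,\mathcal A)$ is $1\to n$-pseudo-broadcastable for every $n\in\mathbb N$.
   Context: An effect is an operator $E$ with $0\le E\le I$. The subtheory $(\mathcal T,\mathcal A)$ is measurement and preparation non-contextual if there exist operators $\{\tilde G_\lambda\}_\lambda$ and $\{\tilde\sigma_\lambda\}_\lambda$ on $\mathcal H$ (finite index set) such that $\mathrm{tr}[\rho E]=\sum_\lambda\mathrm{tr}[\rho\tilde G_\lambda]\mathrm{tr}[\tilde\sigma_\lambda E]$ for all $\rho\in\mathcal T$, $E\in\mathcal A$, where $\mathrm{tr}[\rho\tilde G_\lambda]\ge0$ and $\sum_\lambda\mathrm{tr}[\rho\tilde G_\lambda]=1$ for all $\rho\in\mathcal T$, and $\mathrm{tr}[\tilde\sigma_\lambda E]\ge0$, $\mathrm{tr}[\tilde\sigma_\lambda]=1$ for all $\lambda$ and all $E\in\mathcal A$ (the operators need not be positive). $(\mathcal T,\mathcal A)$ is $1\to n$-pseudo-broadcastable if there is a trace-preserving linear map $\Xi:\mathcal L(\mathcal H)\to\mathcal L(\mathcal H^{\otimes n})$ (not necessarily positive) such that $\mathrm{tr}[A\,\mathrm{tr}_{i^c}\Xi(\rho)]=\mathrm{tr}[A\rho]$ for all $i\in\{1,\dots,n\}$, $\rho\in\mathcal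 T$, $A\in\mathcal A$, and $\mathrm{tr}[\Xi(\rho)\,(A_1\otimes\cdots\otimes A_n)]\ge0$ for all $\rho\in\mathcal T$ and $A_1,\dots,A_n\in\mathcal A$; here $\mathrm{tr}_{i^c}$ is the partial trace over all tensor factors except the $i$-th. *)

theory Defs
  imports Complex_Main "HOL-Library.Complex_Order"
begin

text \<open>The Hilbert space is \<open>\<complex>^d\<close>. Operators on it are represented as functions
  \<open>nat \<Rightarrow> nat \<Rightarrow> complex\<close> (matrix entries), of which only the entries with indices
  \<open>< d\<close> are meaningful. Operators on \<open>H^{\<otimes>n}\<close> are functions on multi-indices
  (lists of length n with entries \<open>< d\<close>). The order on complex numbers is the
  one of Complex_Order: \<open>0 \<le> z\<close> iff z is real and nonnegative.\<close>

type_synonym cmat = "nat \<Rightarrow> nat \<Rightarrow> complex"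
type_synonym tmat = "nat list \<Rightarrow> nat list \<Rightarrow> complex"

definition supported :: "nat \<Rightarrow> cmat \<Rightarrow> bool" where
  "supported d M \<longleftrightarrow> (\<forall>i j. \<not> (i < d \<and> j < d) \<longrightarrow> M i j = 0)"

definition mtrace :: "nat \<Rightarrow> cmat \<Rightarrow> complex" where
  "mtrace d M = (\<Sum>i<d. M i i)"

definition tr_prod :: "nat \<Rightarrow> cmat \<Rightarrow> cmat \<Rightarrow> complex" where
  "tr_prod d A B = (\<Sum>i<d. \<Sum>j<d. A i j * B j i)"

definition psd :: "nat \<Rightarrow> cmat \<Rightarrow> bool" where
  "psd d M \<longleftrightarrow> supported d M \<and>
     (\<forall>v :: nat \<Rightarrow> complex. 0 \<le> (\<Sum>i<d. \<Sum>j<d. cnj (v i) * M i j * v j))"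

definition identity :: "nat \<Rightarrow> cmat" where
  "identity d = (\<lambda>i j. if i = j \<and> i < d then 1 else 0)"

definition is_state :: "nat \<Rightarrow> cmat \<Rightarrow> bool" where
  "is_state d \<rho> \<longleftrightarrow> psd d \<rho> \<and> mtrace d \<rho> = 1"

definition is_effect :: "nat \<Rightarrow> cmat \<Rightarrow> bool" where
  "is_effect d E \<longleftrightarrow> psd d E \<and> psd d (\<lambda>i j. identity d i j - E i j)"

definition convex_mats :: "cmat set \<Rightarrow> bool" where
  "convex_mats S \<longleftrightarrow> (\<forall>X\<in>S. \<forall>Y\<in>S. \<forall>t::real. 0 \<le> t \<and> t \<le> 1 \<longrightarrow>
      (\<lambda>i j. complex_of_real t * X i j + complex_of_real (1 - t) * Y i j) \<in> S)"

definition idx :: "nat \<Rightarrow> nat \<Rightarrow> nat list set" where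
  "idx d n = {xs. length xs = n \<and> set xs \<subseteq> {..<d}}"

definition ttrace :: "nat \<Rightarrow> nat \<Rightarrow> tmat \<Rightarrow> complex" where
  "ttrace d n X = (\<Sum>x\<in>idx d n. X x x)"

definition ins_at :: "nat \<Rightarrow> nat \<Rightarrow> nat list \<Rightarrow> nat list" where
  "ins_at i a ys = take i ys @ a # drop i ys"

definition ptrace_compl :: "nat \<Rightarrow> nat \<Rightarrow> nat \<Rightarrow> tmat \<Rightarrow> cmat" where
  "ptrace_compl d n i X = (\<lambda>a b. if a < d \<and> b < d then
      (\<Sum>y\<in>idx d (n - 1). X (ins_at i a y) (ins_at i b y)) else 0)"

definition tensor :: "cmat list \<Rightarrow> tmat" where
  "tensor As = (\<lambda>x y. \<Prod>k<length As. (As ! k) (x ! k) (y ! k))"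

definition ttr_prod :: "nat \<Rightarrow> nat \<Rightarrow> tmat \<Rightarrow> tmat \<Rightarrow> complex" where
  "ttr_prod d n X Y = (\<Sum>x\<in>idx d n. \<Sum>y\<in>idx d n. X x y * Y y x)"

definition mp_noncontextual :: "nat \<Rightarrow> cmat set \<Rightarrow> cmat set \<Rightarrow> bool" where
  "mp_noncontextual d T A \<longleftrightarrow>
    (\<exists>(k::nat) (G::nat \<Rightarrow> cmat) (\<sigma>::nat \<Rightarrow> cmat).
       (\<forall>l<k. supported d (G l) \<and> supported d (\<sigma> l)) \<and>
       (\<forall>\<rho>\<in>T. \<forall>E\<in>A. tr_prod d \<rho> E = (\<Sum>l<k. tr_prod d \<rho> (G l) * tr_prod d (\<sigma> l) E)) \<and>
       (\<forall>\<rho>\<in>T. (\<forall>l<k. 0 \<le> tr_prod d \<rho> (G l)) \<and> (\<Sum>l<k. tr_prod d \<rho> (G l)) = 1) \<and>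
       (\<forall>l<k. (\<forall>E\<in>A. 0 \<le> tr_prod d (\<sigma> l) E) \<and> mtrace d (\<sigma> l) = 1))"

definition pseudo_broadcastable :: "nat \<Rightarrow> nat \<Rightarrow> cmat set \<Rightarrow> cmat set \<Rightarrow> bool" where
  "pseudo_broadcastable d n T A \<longleftrightarrow>
    (\<exists>\<Xi> :: cmat \<Rightarrow> tmat.
       (\<forall>a b X Y. supported d X \<longrightarrow> supported d Y \<longrightarrow>
          (\<forall>x\<in>idx d n. \<forall>y\<in>idx d n.
             \<Xi> (\<lambda>i j. a * X i j + b * Y i j) x y = a * \<Xi> X x y + b * \<Xi> Y x y)) \<and>
       (\<forall>X. supported d X \<longrightarrow> ttrace d n (\<Xi> X) = mtrace d X) \<and>
       (\<forall>i<n. \<forall>\<rho>\<in>T. \<forall>E\<in>A. tr_prod d E (ptrace_compl d n i (\<Xi> \<rho>)) = tr_prod d E \<rho>) \<and>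
       (\<forall>\<rho>\<in>T. \<forall>As. length As = n \<longrightarrow> set As \<subseteq> A \<longrightarrow>
          0 \<le> ttr_prod d n (\<Xi> \<rho>) (tensor As)))"

end

theory Submission
  imports Defs "HOL-Analysis.Analysis"
begin

text \<open>A noncontextual model is a measure-and-prepare decomposition \<open>\<Sum>\<^sub>l tr[\<rho> G_l] tr[\<sigma>_l E]\<close>, and
  preparing \<open>n\<close> copies of \<open>\<sigma>_l\<close> broadcasts. Conversely, measure all \<open>n\<close> broadcast copies with an
  informationally complete measurement. The probabilities of the outcome strings are linear in \<open>\<rho>\<close>, and
  the empirical frequencies of a string define a linear functional on the effects; averaging these
  functionals reproduces \<open>tr[\<rho> E]\<close> exactly. By a Chernoff bound they are, with probability tending to 1,
  almost positive on any given finite set of effects. This gives approximate decompositions; by the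
  conic Caratheodory theorem they need a number of terms independent of \<open>n\<close>, so compactness
  yields an exact one.\<close>

subsection \<open>Separable models in coordinates\<close>

text \<open>The \<open>n\<close> copies may be correlated in any way and the broadcast operator is
  positive only on products of effects from \<open>A\<close>, so an outcome string is not a sequence
  of independent trials. Large deviations are still accessible because \<open>I - t E\<close> lies
  in \<open>A\<close>: the exponential moment of a string is itself the value on an admissible
  product. String probabilities are nonnegative on all of \<open>T\<close>, so positivity on states
  is exact in every approximating model; only positivity on effects has to be approximated. The
  bound serves finitely many effects at a time, with \<open>n\<close> depending on them, so reaching
  all of \<open>A\<close> takes a limit inside one fixed compact cube. Three bounds supply it:
  \<open>r * m\<close> terms, with \<open>r\<close> and \<open>m\<close> the sizes of bases taken
  from \<open>T\<close> and \<open>A\<close>; empirical values in \<open>[0, m]\<close>, the range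
  of the values assigned to outcomes; and state weights at most 2, since for each basis state they
  add up to about 1. Coordinates on the two spans make this a limit of real arrays. Dual bases turn
  coordinate functionals back into operators \<open>G_l\<close> and \<open>\<sigma>_l\<close>, which
  therefore have controlled signs only on \<open>T\<close> and \<open>A\<close>.\<close>

lemma exists_dual_basis:
  fixes v0 :: "'a \<Rightarrow> 'b::field"
  assumes "finite J" "v0 \<in> V" "x0 \<in> J" "v0 x0 \<noteq> 0"
  obtains m :: nat and b D where "0 < m" "b 0 = v0" "\<And>j. j < m \<Longrightarrow> b j \<in> V"
    "\<And>j k. j < m \<Longrightarrow> k < m \<Longrightarrow> (\<Sum>y\<in>J. b j y * D k y) = (if j = k then 1 else 0)"
    "\<And>v x. v \<in> V \<Longrightarrow> x \<in> J \<Longrightarrow> v x = (\<Sum>j<m. (\<Sum>y\<in>J. v y * D j y) * b j x)"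
proof -
  define f where "f v D = (\<Sum>y\<in>J. v y * D y)" for v D :: "'a \<Rightarrow> 'b"
  \<comment> \<open>Invariant of an induction over positions: \<open>D\<close> is dual to
    \<open>b\<close>, and the expansion of every \<open>v\<close> in \<open>V\<close> is already
    correct at the positions in \<open>K\<close>. Each new position costs at most one new basis
    vector.\<close>
  define Q where "Q K m b D \<longleftrightarrow> 0 < m \<and> b 0 = v0 \<and> (\<forall>j<m. b j \<in> V) \<and>
      (\<forall>j<m. \<forall>k<m. f (b j) (D k) = (if j = k then 1 else 0)) \<and>
      (\<forall>v\<in>V. \<forall>x\<in>K. v x = (\<Sum>j<m. f v (D j) * b j x))" for K and m :: nat and b D
  have step: "\<exists>m b D. Q (insert x K) m b D" if Q: "Q K m b D" and x: "x \<in> J" for K x m b D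
  proof -
    define r where "r v y = v y - (\<Sum>j<m. f v (D j) * b j y)" for v y
    show ?thesis
    proof (cases "\<forall>v\<in>V. r v x = 0")
      case True
      then have "Q (insert x K) m b D" using Q by (auto simp: Q_def r_def)
      then show ?thesis by blast
    next
      case False
      then obtain u where u: "u \<in> V" "r u x \<noteq> 0" by blast
      \<comment> \<open>\<open>N\<close> represents the functional \<open>r v x / r u x\<close>, the
        residual at \<open>x\<close> normalised to 1 at \<open>u\<close>. It kills the old basis
        vectors, whose residuals vanish.\<close>
      define N where "N y = ((if y = x then 1 else 0) - (\<Sum>j<m. b j x * D j y)) / r u x" for y
      have fN: "f v N = r v x / r u x" for v
      proof -
        have "f v N = (\<Sum>y\<in>J. v y * (if y = x then 1 else 0) - v y * (\<Sum>j<m. b j x * D j y)) / r u x"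
          by (simp add: f_def N_def sum_divide_distrib right_diff_distrib)
        also have "(\<Sum>y\<in>J. v y * (if y = x then 1 else 0) - v y * (\<Sum>j<m. b j x * D j y))
            = v x - (\<Sum>y\<in>J. \<Sum>j<m. v y * (b j x * D j y))"
          using x assms(1) by (simp add: sum_subtractf sum_distrib_left if_distrib[of "(*) _"] cong: if_cong)
        also have "(\<Sum>y\<in>J. \<Sum>j<m. v y * (b j x * D j y)) = (\<Sum>j<m. f v (D j) * b j x)"
          unfolding f_def by (subst sum.swap) (simp add: sum_distrib_left sum_distrib_right mult_ac)
        finally show ?thesis by (simp add: r_def)
      qed
      have rb: "r (b j) y = 0" if "j < m" for j y
      proof -
        have "(\<Sum>k<m. f (b j) (D k) * b k y) = (\<Sum>k<m. if j = k then b k y else 0)"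
          using Q that by (intro sum.cong) (auto simp: Q_def)
        then show ?thesis using that by (simp add: r_def)
      qed
      define b' where "b' = b(m := u)"
      \<comment> \<open>Subtracting a multiple of \<open>N\<close> makes each old dual vector vanish
        on \<open>u\<close> without changing its values on the old basis.\<close>
      define D' where "D' j = (if j < m then (\<lambda>y. D j y - f u (D j) * N y) else N)" for j
      have fD': "f v (D' j) = (if j < m then f v (D j) - f u (D j) * f v N else f v N)" for v j
      proof -
        have "f v (\<lambda>y. D j y - c * N y) = f v (D j) - c * f v N" for c
          by (simp add: f_def right_diff_distrib sum_subtractf sum_distrib_left mult.left_commute)
        then show ?thesis by (simp add: D'_def)
      qed
      have "Q (insert x K) (Suc m) b' D'"
        unfolding Q_def
      proof (intro conjI allI impI ballI)
        show "0 < Suc m" by simp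
        show "b' 0 = v0" using Q by (auto simp: b'_def Q_def)
        show "b' j \<in> V" if "j < Suc m" for j
          using that u Q by (auto simp: b'_def Q_def less_Suc_eq)
        show "f (b' j) (D' k) = (if j = k then 1 else 0)" if "j < Suc m" "k < Suc m" for j k
          using that u Q by (auto simp: b'_def Q_def less_Suc_eq fD' fN rb)
        show "v y = (\<Sum>j<Suc m. f v (D' j) * b' j y)" if v: "v \<in> V" and y: "y \<in> insert x K" for v y
        proof -
          have "(\<Sum>j<Suc m. f v (D' j) * b' j y)
              = (\<Sum>j<m. f v (D j) * b j y) - f v N * (\<Sum>j<m. f u (D j) * b j y) + f v N * u y"
            by (simp add: fD' b'_def left_diff_distrib sum_subtractf sum_distrib_left mult.assoc mult.left_commute[of "f v N"])
          also have "\<dots> = v y - r v y + f v N * r u y"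
            by (simp add: r_def algebra_simps)
          also have "\<dots> = v y"
          proof (cases "y = x")
            case True then show ?thesis using u by (simp add: fN)
          next
            case False
            then have "r v y = 0" "r u y = 0" using Q v u y by (auto simp: r_def Q_def)
            then show ?thesis by simp
          qed
          finally show ?thesis by simp
        qed
      qed
      then show ?thesis by blast
    qed
  qed
  have base: "\<exists>m b D. Q {x0} m b D"
  proof (intro exI)
    \<comment> \<open>Starting with \<open>v0\<close> alone pins it to index 0, since later vectors
      are appended. For effects this will be the unit effect.\<close>
    define D :: "nat \<Rightarrow> 'a \<Rightarrow> 'b" where "D = (\<lambda>_ y. if y = x0 then 1 / v0 x0 else 0)"
    have "f v (D j) = v x0 / v0 x0" for v j
      using assms by (simp add: f_def D_def mult_delta_right if_distrib cong: if_cong)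
    then show "Q {x0} 1 (\<lambda>_. v0) D"
      using assms by (auto simp: Q_def)
  qed
  have "\<exists>m b D. Q (insert x0 K) m b D" if "K \<subseteq> J" for K
    using finite_subset[OF that assms(1)] that
  proof (induction K rule: finite_induct)
    case empty show ?case using base by simp
  next
    case (insert x K)
    then obtain m b D where "Q (insert x0 K) m b D" by auto
    from step[OF this, of x] insert.prems show ?case by (simp add: insert_commute)
  qed
  from this[of J] obtain m b D where "Q J m b D"
    using assms(3) by (auto simp: insert_absorb)
  then show thesis using that[of m b D] unfolding Q_def f_def by blast
qed

section \<open>Linear relations and the conic Caratheodory theorem\<close>

lemma nontrivial_linear_relation:
  fixes v :: "'s \<Rightarrow> 'x \<Rightarrow> real"
  assumes "finite X" "finite U" "card X < card U"
  shows "\<exists>\<mu>. (\<exists>s\<in>U. \<mu> s \<noteq> 0) \<and> (\<forall>x\<in>X. (\<Sum>s\<in>U. \<mu> s * v s x) = 0)"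
  using assms
proof (induction X arbitrary: U v rule: finite_induct)
  case empty
  then have "U \<noteq> {}" by auto
  then show ?case by (intro exI[of _ "\<lambda>_. 1"]) auto
next
  case (insert x X)
  show ?case
  proof (cases "\<forall>s\<in>U. v s x = 0")
    case True
    have "card X < card U" using insert by simp
    from insert.IH[OF insert.prems(1) this, of v] show ?thesis using True by auto
  next
    case False
    then obtain s0 where s0: "s0 \<in> U" "v s0 x \<noteq> 0" by blast
    \<comment> \<open>Elimination with pivot \<open>s0\<close>: coordinate \<open>x\<close> of every
      \<open>w s\<close> is 0, so a relation among the \<open>w s\<close> on \<open>X\<close>
      extends to one among the \<open>v s\<close> on \<open>insert x X\<close> by adjusting the
      coefficient of \<open>s0\<close>.\<close>
    define w where "w s y = v s y - v s x / v s0 x * v s0 y" for s y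
    have "card X < card (U - {s0})" using insert s0 by (simp add: card_Diff_singleton)
    from insert.IH[OF _ this, of w] insert.prems obtain \<nu> where
      \<nu>: "\<exists>s\<in>U - {s0}. \<nu> s \<noteq> 0" "\<And>y. y \<in> X \<Longrightarrow> (\<Sum>s\<in>U - {s0}. \<nu> s * w s y) = 0" by auto
    define c where "c = - (\<Sum>s\<in>U - {s0}. \<nu> s * v s x) / v s0 x"
    define \<mu> where "\<mu> = \<nu>(s0 := c)"
    have eq: "(\<Sum>s\<in>U. \<mu> s * v s y) = (\<Sum>s\<in>U - {s0}. \<nu> s * w s y)" for y
    proof -
      have "(\<Sum>s\<in>U. \<mu> s * v s y) = c * v s0 y + (\<Sum>s\<in>U - {s0}. \<nu> s * v s y)"
        using insert.prems(1) s0 by (simp add: sum.remove[of U s0] \<mu>_def)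
      also have "c * v s0 y = - (\<Sum>s\<in>U - {s0}. \<nu> s * (v s x / v s0 x * v s0 y))"
        unfolding c_def sum_divide_distrib minus_divide_left[symmetric] minus_mult_left[symmetric] sum_distrib_right
        by (simp add: mult_ac)
      finally show ?thesis by (simp add: w_def right_diff_distrib sum_subtractf)
    qed
    have "w s x = 0" for s using s0 by (simp add: w_def)
    then have "\<forall>y\<in>insert x X. (\<Sum>s\<in>U. \<mu> s * v s y) = 0" using \<nu>(2) by (auto simp: eq)
    moreover have "\<exists>s\<in>U. \<mu> s \<noteq> 0" using \<nu>(1) by (auto simp: \<mu>_def)
    ultimately show ?thesis by blast
  qed
qed

text \<open>A reweighting of smallest support works: with more than \<open>card X\<close> nonzero
  weights, a linear relation among the vectors could be subtracted until a weight reaches 0. Only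
  nonnegative weights change, so sign conditions on the individual terms survive.\<close>

lemma conic_caratheodory:
  fixes v :: "'s \<Rightarrow> 'x \<Rightarrow> real"
  assumes "finite X" "finite S"
  obtains t where "\<And>s. 0 \<le> t s" "card {s\<in>S. t s \<noteq> 0} \<le> card X"
    "\<And>x. x \<in> X \<Longrightarrow> (\<Sum>s\<in>S. t s * v s x) = (\<Sum>s\<in>S. v s x)"
proof -
  define good where "good t \<longleftrightarrow> (\<forall>s. 0 \<le> t s) \<and> (\<forall>x\<in>X. (\<Sum>s\<in>S. t s * v s x) = (\<Sum>s\<in>S. v s x))" for t
  define supp where "supp t = {s\<in>S. t s \<noteq> 0}" for t :: "'s \<Rightarrow> real"
  have "good (\<lambda>_. 1)" by (simp add: good_def)
  then obtain t where t: "good t" and min: "\<And>u. good u \<Longrightarrow> card (supp t) \<le> card (supp u)"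
    using arg_min_natI[of good "\<lambda>_. 1" "\<lambda>u. card (supp u)"]
      arg_min_nat_le[of good _ "\<lambda>u. card (supp u)"] by metis
  have fin: "finite (supp t)" using assms by (simp add: supp_def)
  have "card (supp t) \<le> card X"
  proof (rule ccontr)
    assume "\<not> ?thesis"
    then have "card X < card (supp t)" by simp
    from nontrivial_linear_relation[OF assms(1) fin this, of v] obtain \<nu> where
      \<nu>: "\<exists>s\<in>supp t. \<nu> s \<noteq> 0" "\<And>x. x \<in> X \<Longrightarrow> (\<Sum>s\<in>supp t. \<nu> s * v s x) = 0" by auto
    \<comment> \<open>A relation may be negated, so some coefficient can be taken positive;
      otherwise no weight would decrease.\<close>
    obtain \<mu> where \<mu>: "\<exists>s\<in>supp t. \<mu> s > 0" "\<And>x. x \<in> X \<Longrightarrow> (\<Sum>s\<in>supp t. \<mu> s * v s x) = 0"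
    proof (cases "\<exists>s\<in>supp t. \<nu> s > 0")
      case True then show ?thesis using that \<nu> by blast
    next
      case False
      then have "\<exists>s\<in>supp t. - \<nu> s > 0" using \<nu>(1) by (metis linorder_neqE_linordered_idom neg_0_less_iff_less)
      then show ?thesis using that[of "\<lambda>s. - \<nu> s"] \<nu>(2) by (auto simp: sum_negf)
    qed
    define P where "P = {s\<in>supp t. \<mu> s > 0}"
    have P: "finite P" "P \<noteq> {}" using fin \<mu> by (auto simp: P_def)
    \<comment> \<open>Ratio test: the longest step along \<open>\<mu>\<close> that keeps all weights
      nonnegative. The minimiser \<open>s0\<close> drops out of the support.\<close>
    define \<theta> where "\<theta> = Min ((\<lambda>s. t s / \<mu> s) ` P)"
    have "\<theta> \<in> (\<lambda>s. t s / \<mu> s) ` P" unfolding \<theta>_def using P by (intro Min_in) auto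
    then obtain s0 where s0: "s0 \<in> P" "\<theta> = t s0 / \<mu> s0" by auto
    have le: "\<theta> \<le> t s / \<mu> s" if "s \<in> P" for s
      unfolding \<theta>_def using P that by (intro Min_le) auto
    have tnn: "0 \<le> t s" for s using t by (simp add: good_def)
    have \<theta>0: "0 \<le> \<theta>" using s0 tnn by (auto simp: P_def)
    define u where "u s = (if s \<in> supp t then t s - \<theta> * \<mu> s else 0)" for s
    have unn: "0 \<le> u s" for s
    proof (cases "s \<in> P")
      case True
      then have "\<theta> * \<mu> s \<le> t s" using le[OF True] by (simp add: P_def pos_le_divide_eq)
      then show ?thesis by (simp add: u_def)
    next
      case False
      then show ?thesis using tnn[of s] \<theta>0 mult_nonneg_nonpos[of \<theta> "\<mu> s"]
        by (auto simp: u_def P_def)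
    qed
    have restrict: "(\<Sum>s\<in>S. g s * v s x) = (\<Sum>s\<in>supp t. g s * v s x)" if "\<And>s. s \<notin> supp t \<Longrightarrow> s \<in> S \<Longrightarrow> g s = 0" for g x
      using assms that by (intro sum.mono_neutral_right) (auto simp: supp_def)
    have "good u"
      unfolding good_def
    proof (intro conjI allI ballI unn)
      fix x assume x: "x \<in> X"
      have "(\<Sum>s\<in>S. u s * v s x) = (\<Sum>s\<in>supp t. (t s - \<theta> * \<mu> s) * v s x)"
        by (subst restrict) (auto simp: u_def)
      also have "\<dots> = (\<Sum>s\<in>supp t. t s * v s x) - \<theta> * (\<Sum>s\<in>supp t. \<mu> s * v s x)"
        by (simp add: left_diff_distrib sum_subtractf sum_distrib_left mult.assoc)
      also have "\<dots> = (\<Sum>s\<in>S. t s * v s x)"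
        using \<mu>(2)[OF x] by (subst restrict) (auto simp: supp_def)
      also have "\<dots> = (\<Sum>s\<in>S. v s x)" using t x by (simp add: good_def)
      finally show "(\<Sum>s\<in>S. u s * v s x) = (\<Sum>s\<in>S. v s x)" .
    qed
    moreover have "supp u \<subset> supp t"
    proof -
      have "supp u \<subseteq> supp t" by (auto simp: supp_def u_def)
      moreover have "s0 \<in> supp t" "s0 \<notin> supp u" using s0 by (auto simp: P_def u_def supp_def)
      ultimately show ?thesis by blast
    qed
    then have "card (supp u) < card (supp t)" using fin by (rule psubset_card_mono[rotated])
    ultimately show False using min[of u] by simp
  qed
  then show thesis using that[of t] t by (auto simp: good_def supp_def)
qed

text \<open>\<open>M\<close> is the bilinear form \<open>(\<rho>, E) \<mapsto> tr[\<rho> E]\<close> on a basis of the span of the states (index \<open>i < r\<close>) and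
  one of the effects (index \<open>j < m\<close>, where \<open>j = 0\<close> is the unit effect); \<open>C\<close> and \<open>B\<close> hold the coordinate
  vectors of states and effects. Only positivity on the effects and agreement with \<open>M\<close> are relaxed by \<open>\<delta>\<close>.\<close>

definition separable_model ::
    "nat \<Rightarrow> nat \<Rightarrow> (nat \<Rightarrow> real) set \<Rightarrow> (nat \<Rightarrow> real) set \<Rightarrow> (nat \<Rightarrow> nat \<Rightarrow> real) \<Rightarrow> real \<Rightarrow>
     's set \<Rightarrow> ('s \<Rightarrow> nat \<Rightarrow> real) \<Rightarrow> ('s \<Rightarrow> nat \<Rightarrow> real) \<Rightarrow> bool" where
  "separable_model r m C B M \<delta> S p q \<longleftrightarrow>
     (\<forall>s\<in>S. \<forall>i<r. 0 \<le> p s i) \<and>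
     (\<forall>s\<in>S. \<forall>c\<in>C. 0 \<le> (\<Sum>i<r. c i * p s i)) \<and>
     (\<forall>s\<in>S. q s 0 = 1) \<and>
     (\<forall>s\<in>S. \<forall>e\<in>B. - \<delta> \<le> (\<Sum>j<m. e j * q s j)) \<and>
     (\<forall>i<r. \<forall>j<m. \<bar>(\<Sum>s\<in>S. p s i * q s j) - M i j\<bar> \<le> \<delta>)"

lemma separable_model_mono:
  assumes "separable_model r m C B M \<delta> S p q" "B' \<subseteq> B" "\<delta> \<le> \<delta>'"
  shows "separable_model r m C B' M \<delta>' S p q"
  using assms unfolding separable_model_def by (meson dual_order.trans neg_le_iff_le subsetD)

text \<open>Caratheodory is applied to the \<open>r\<close> by \<open>m\<close> matrices
  \<open>p s i * q s j\<close>, whose sum is kept. The weights are absorbed into \<open>p\<close>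
  alone, so the normalisation of \<open>q\<close> and its bounds are untouched.\<close>

lemma separable_model_few_terms:
  assumes S: "finite S" and sm: "separable_model r m C B M \<delta> S p q"
    and q: "\<And>s j. s \<in> S \<Longrightarrow> j < m \<Longrightarrow> 0 \<le> q s j \<and> q s j \<le> R"
    and "S \<noteq> {}"
  obtains p' q' where "separable_model r m C B M \<delta> {..<r * m} p' q'"
    "\<And>l j. l < r * m \<Longrightarrow> j < m \<Longrightarrow> 0 \<le> q' l j \<and> q' l j \<le> R"
proof -
  obtain s0 where s0: "s0 \<in> S" using assms(4) by blast
  obtain t where t: "\<And>s. 0 \<le> t s" "card {s\<in>S. t s \<noteq> 0} \<le> card ({..<r} \<times> {..<m})"
    "\<And>x. x \<in> {..<r} \<times> {..<m} \<Longrightarrow>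
      (\<Sum>s\<in>S. t s * (p s (fst x) * q s (snd x))) = (\<Sum>s\<in>S. p s (fst x) * q s (snd x))"
    using conic_caratheodory[of "{..<r} \<times> {..<m}" S "\<lambda>s x. p s (fst x) * q s (snd x)"] S by auto
  define U where "U = {s\<in>S. t s \<noteq> 0}"
  have U: "finite U" "U \<subseteq> S" "card U \<le> r * m" using S t(2) by (auto simp: U_def)
  obtain h where h: "bij_betw h {..<card U} U"
    using ex_bij_betw_nat_finite[OF U(1)] by (auto simp: lessThan_atLeast0)
  have hU: "h l \<in> U" if "l < card U" for l using h that by (auto simp: bij_betw_def)
  define p' where "p' l i = (if l < card U then t (h l) * p (h l) i else 0)" for l i
  \<comment> \<open>Padding up to exactly \<open>r * m\<close> terms: surplus terms have
    \<open>p' = 0\<close>, but their \<open>q'\<close> must still be normalised and almost positive,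
    hence the copy of \<open>q s0\<close>.\<close>
  define q' where "q' l = (if l < card U then q (h l) else q s0)" for l
  have sums: "(\<Sum>l<r * m. p' l i * q' l j) = (\<Sum>s\<in>S. p s i * q s j)" if "i < r" "j < m" for i j
  proof -
    have "(\<Sum>l<r * m. p' l i * q' l j) = (\<Sum>l<card U. t (h l) * (p (h l) i * q (h l) j))"
      using U(3) by (intro sum.mono_neutral_cong_right) (auto simp: p'_def q'_def)
    also have "\<dots> = (\<Sum>s\<in>U. t s * (p s i * q s j))"
      by (rule sum.reindex_bij_betw[OF h])
    also have "\<dots> = (\<Sum>s\<in>S. t s * (p s i * q s j))"
      using S by (intro sum.mono_neutral_left) (auto simp: U_def)
    also have "\<dots> = (\<Sum>s\<in>S. p s i * q s j)" using t(3)[of "(i, j)"] that by simp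
    finally show ?thesis .
  qed
  have hS: "l < card U \<Longrightarrow> h l \<in> S" for l using hU U by blast
  have scale: "(\<Sum>i<r. c i * (t s * p s i)) = t s * (\<Sum>i<r. c i * p s i)" for c s
    by (simp add: sum_distrib_left mult_ac)
  have p'_sum: "(\<Sum>i<r. c i * p' l i) = (if l < card U then t (h l) * (\<Sum>i<r. c i * p (h l) i) else 0)"
    for c l by (simp add: p'_def scale)
  have p'_nonneg: "0 \<le> p' l i" if "i < r" for l i
    using sm hS t(1) that by (auto simp: p'_def separable_model_def)
  have "separable_model r m C B M \<delta> {..<r * m} p' q'"
    using sm hS s0 t(1) sums p'_nonneg unfolding separable_model_def
    by (auto simp: p'_sum q'_def)
  moreover have "0 \<le> q' l j \<and> q' l j \<le> R" if "l < r * m" "j < m" for l j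
    using q hS s0 that by (auto simp: q'_def)
  ultimately show thesis using that by blast
qed

section \<open>Compactness: from approximate models to an exact one\<close>

lemma closed_separable_model:
  "closed {z :: bool \<times> nat \<times> nat \<Rightarrow> real. separable_model r m C B M \<delta> {..<k}
     (\<lambda>l i. z (True, l, i)) (\<lambda>l j. z (False, l, j))}"
  unfolding separable_model_def imp_conjL[symmetric] Ball_def
  by (intro closed_Collect_conj closed_Collect_all closed_Collect_imp closed_Collect_le
      closed_Collect_eq open_Collect_const continuous_intros continuous_on_product_coordinates)

lemma compact_cube: "compact {z :: 'a \<Rightarrow> real. \<forall>x. 0 \<le> z x \<and> z x \<le> R}"
proof -
  have "compactin (product_topology (\<lambda>_. euclidean) UNIV) (PiE UNIV (\<lambda>_::'a. {0..R::real}))"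
    by (subst compactin_PiE) auto
  moreover have "PiE UNIV (\<lambda>_::'a. {0..R::real}) = {z. \<forall>x. 0 \<le> z x \<and> z x \<le> R}"
    by (auto simp: PiE_def)
  ultimately show ?thesis by (simp add: euclidean_product_topology[symmetric] flip: compactin_euclidean_iff)
qed

text \<open>Finite intersection property: finitely many constraints, each an effect with a
  tolerance, are met by one approximate model for these effects at the smallest tolerance. A point
  satisfying all constraints is an exact model.\<close>

lemma exact_separable_model:
  fixes M :: "nat \<Rightarrow> nat \<Rightarrow> real"
  assumes m: "0 < m" and M0: "\<And>i. i < r \<Longrightarrow> M i 0 = 1" and "E \<noteq> {}"
    and approx: "\<And>B \<delta>. finite B \<Longrightarrow> B \<subseteq> E \<Longrightarrow> 0 < \<delta> \<Longrightarrow>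
      \<exists>(S::'s set) p q. finite S \<and> S \<noteq> {} \<and> separable_model r m C B M \<delta> S p q \<and>
        (\<forall>s\<in>S. \<forall>j<m. 0 \<le> q s j \<and> q s j \<le> R)"
  obtains p q where "separable_model r m C E M 0 {..<r * m} p q"
proof -
  define k where "k = r * m"
  \<comment> \<open>A model is encoded as a single point \<open>z\<close> of a product space; the
    flag separates \<open>p\<close> from \<open>q\<close>.\<close>
  define P :: "(bool \<times> nat \<times> nat \<Rightarrow> real) \<Rightarrow> nat \<Rightarrow> nat \<Rightarrow> real" where "P z l i = z (True, l, i)" for z l i
  define Q :: "(bool \<times> nat \<times> nat \<Rightarrow> real) \<Rightarrow> nat \<Rightarrow> nat \<Rightarrow> real" where "Q z l i = z (False, l, i)" for z l i
  \<comment> \<open>The 2 bounds \<open>p\<close>: as \<open>q l 0 = 1\<close>, the weights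
    \<open>p l i\<close> sum over \<open>l\<close> to at most
    \<open>M i 0 + \<delta> \<le> 2\<close>. \<open>R\<close> bounds \<open>q\<close>.\<close>
  define K where "K = {z :: bool \<times> nat \<times> nat \<Rightarrow> real. \<forall>x. 0 \<le> z x \<and> z x \<le> max 2 R}"
  define Z where "Z e \<delta> = {z. separable_model r m C {e} M \<delta> {..<k} (P z) (Q z)}" for e \<delta>
  define I where "I = E \<times> {0<..(1::real)}"
  have "K \<inter> \<Inter> ((\<lambda>(e, \<delta>). Z e \<delta>) ` I) \<noteq> {}"
  proof (rule compact_imp_fip)
    show "compact K" unfolding K_def by (rule compact_cube)
    show "closed T" if "T \<in> (\<lambda>(e, \<delta>). Z e \<delta>) ` I" for T
      using that closed_separable_model unfolding Z_def P_def Q_def by auto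
    fix F assume "finite F" "F \<subseteq> (\<lambda>(e, \<delta>). Z e \<delta>) ` I"
    then obtain I' where I': "finite I'" "I' \<subseteq> I" "F = (\<lambda>(e, \<delta>). Z e \<delta>) ` I'"
      by (meson finite_subset_image)
    \<comment> \<open>Inserting 1 keeps the minimum meaningful for empty \<open>I'\<close> and
      guarantees \<open>\<delta> \<le> 1\<close>.\<close>
    define \<delta> where "\<delta> = Min (insert 1 (snd ` I'))"
    have \<delta>: "0 < \<delta>" "\<delta> \<le> 1" "\<And>x. x \<in> I' \<Longrightarrow> \<delta> \<le> snd x"
      using I' by (auto simp: \<delta>_def I_def)
    have "finite (fst ` I')" "fst ` I' \<subseteq> E" using I' by (auto simp: I_def)
    from approx[OF this \<delta>(1)] obtain S :: "'s set" and p0 q0 where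
      S: "finite S" "S \<noteq> {}" "separable_model r m C (fst ` I') M \<delta> S p0 q0"
        "\<And>s j. s \<in> S \<Longrightarrow> j < m \<Longrightarrow> 0 \<le> q0 s j \<and> q0 s j \<le> R" by blast
    obtain p q where sm: "separable_model r m C (fst ` I') M \<delta> {..<k} p q"
        and q: "\<And>l j. l < k \<Longrightarrow> j < m \<Longrightarrow> 0 \<le> q l j \<and> q l j \<le> R"
      unfolding k_def using separable_model_few_terms[OF S(1,3,4,2)] by blast
    have p: "0 \<le> p l i \<and> p l i \<le> 2" if "l < k" "i < r" for l i
    proof -
      have nn: "\<And>l. l < k \<Longrightarrow> 0 \<le> p l i" using sm \<open>i < r\<close> by (auto simp: separable_model_def)
      have "p l i \<le> (\<Sum>l<k. p l i)" using that nn by (intro member_le_sum) auto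
      also have "\<dots> = (\<Sum>l<k. p l i * q l 0)" using sm by (auto simp: separable_model_def)
      also have "\<dots> \<le> M i 0 + \<delta>"
      proof -
        have "\<bar>(\<Sum>l<k. p l i * q l 0) - M i 0\<bar> \<le> \<delta>"
          using sm m \<open>i < r\<close> unfolding separable_model_def by blast
        then show ?thesis by linarith
      qed
      finally show ?thesis using M0[OF \<open>i < r\<close>] \<delta>(2) nn that by auto
    qed
    \<comment> \<open>The cube constrains every coordinate, so the meaningless ones are set to
      0.\<close>
    define z where "z = (\<lambda>(b, l, i). if l < k then if b then (if i < r then p l i else 0)
                           else (if i < m then q l i else 0) else 0)"
    have "z \<in> K" using p q by (auto simp: K_def z_def le_max_iff_disj)
    moreover have "z \<in> Z e \<epsilon>" if "(e, \<epsilon>) \<in> I'" for e \<epsilon>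
    proof -
      have "separable_model r m C {e} M \<epsilon> {..<k} p q"
        by (rule separable_model_mono[OF sm]) (use that \<delta>(3)[OF that] in force)+
      then show ?thesis using m
        by (simp add: Z_def P_def Q_def z_def separable_model_def)
    qed
    ultimately show "K \<inter> \<Inter> F \<noteq> {}" unfolding I'(3) by auto
  qed
  then obtain z where z: "\<And>e \<delta>. e \<in> E \<Longrightarrow> 0 < \<delta> \<Longrightarrow> \<delta> \<le> 1 \<Longrightarrow> z \<in> Z e \<delta>"
    unfolding I_def by fastforce
  obtain e0 where "e0 \<in> E" using assms(3) by blast
  have zero: "0 \<le> x" if "\<And>\<delta>. 0 < \<delta> \<Longrightarrow> \<delta> \<le> 1 \<Longrightarrow> - \<delta> \<le> x" for x :: real
  proof (rule ccontr)
    assume "\<not> 0 \<le> x"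
    moreover have "- 1 \<le> x" using that[of 1] by simp
    ultimately show False using that[of "- x / 2"] by simp
  qed
  have "separable_model r m C E M 0 {..<k} (P z) (Q z)"
    unfolding separable_model_def
  proof (intro conjI ballI allI impI)
    show "- 0 \<le> (\<Sum>j<m. e j * Q z l j)" if "l \<in> {..<k}" "e \<in> E" for l e
      using z[OF that(2)] that(1) by (simp, intro zero) (auto simp: Z_def separable_model_def)
    show "\<bar>(\<Sum>l<k. P z l i * Q z l j) - M i j\<bar> \<le> 0" if "i < r" "j < m" for i j
    proof -
      have "0 \<le> - \<bar>(\<Sum>l<k. P z l i * Q z l j) - M i j\<bar>"
        using z[OF \<open>e0 \<in> E\<close>] that by (intro zero) (auto simp: Z_def separable_model_def)
      then show ?thesis by simp
    qed
  qed (use z[OF \<open>e0 \<in> E\<close>, of 1] in \<open>auto simp: Z_def separable_model_def\<close>)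
  then show thesis using that unfolding k_def by blast
qed


subsection \<open>Product observables on multi-indices\<close>

lemma idx_0 [simp]: "idx d 0 = {[]}"
  by (auto simp: idx_def)

lemma idx_Suc: "idx d (Suc n) = (\<lambda>(a, x). a # x) ` ({..<d} \<times> idx d n)"
  by (auto simp: idx_def image_iff length_Suc_conv)

lemma finite_idx [simp]: "finite (idx d n)"
  by (induction n) (auto simp: idx_Suc)

lemma idx_nth_less: "x \<in> idx d n \<Longrightarrow> k < n \<Longrightarrow> x ! k < d"
  by (auto simp: idx_def subset_iff)

lemma sum_idx_prod:
  fixes h :: "nat \<Rightarrow> nat \<Rightarrow> 'a::comm_ring_1"
  shows "(\<Sum>x\<in>idx d n. \<Prod>k<n. h k (x ! k)) = (\<Prod>k<n. \<Sum>a<d. h k a)"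
proof (induction n arbitrary: h)
  case 0
  then show ?case by simp
next
  case (Suc n)
  have "(\<Sum>x\<in>idx d (Suc n). \<Prod>k<Suc n. h k (x ! k))
      = (\<Sum>(a, x)\<in>{..<d} \<times> idx d n. h 0 a * (\<Prod>k<n. h (Suc k) (x ! k)))"
    unfolding idx_Suc
    by (subst sum.reindex)
      (auto simp: inj_on_def prod.lessThan_Suc_shift simp del: prod.lessThan_Suc intro!: sum.cong)
  also have "\<dots> = (\<Sum>a<d. h 0 a) * (\<Sum>x\<in>idx d n. \<Prod>k<n. h (Suc k) (x ! k))"
    by (simp add: sum.cartesian_product[symmetric] sum_product)
  also have "\<dots> = (\<Prod>k<Suc n. \<Sum>a<d. h k a)"
    by (simp add: Suc[of "\<lambda>k. h (Suc k)"] prod.lessThan_Suc_shift del: prod.lessThan_Suc)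
  finally show ?case .
qed

text \<open>This is the trace of \<open>X\<close> against the tensor product of the
  \<open>f k\<close>. A family indexed by slots, instead of a list, makes it easy to vary a single
  slot or to expand all slots over choice functions.\<close>

definition slot_tr :: "nat \<Rightarrow> nat \<Rightarrow> tmat \<Rightarrow> (nat \<Rightarrow> cmat) \<Rightarrow> complex" where
  "slot_tr d n X f = (\<Sum>x\<in>idx d n. \<Sum>y\<in>idx d n. X x y * (\<Prod>k<n. f k (y ! k) (x ! k)))"

lemma ttr_prod_tensor: "length As = n \<Longrightarrow> ttr_prod d n X (tensor As) = slot_tr d n X (\<lambda>k. As ! k)"
  by (simp add: ttr_prod_def tensor_def slot_tr_def)

lemma slot_tr_cong:
  assumes "\<And>k x y. k < n \<Longrightarrow> x < d \<Longrightarrow> y < d \<Longrightarrow> f k x y = g k x y"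
  shows "slot_tr d n X f = slot_tr d n X g"
  unfolding slot_tr_def
  by (intro sum.cong refl arg_cong2[where f = "(*)"] prod.cong) (auto intro: assms idx_nth_less)

lemma ttr_prod_tensor_map: "ttr_prod d n X (tensor (map f [0..<n])) = slot_tr d n X f"
  by (subst ttr_prod_tensor) (auto intro: slot_tr_cong)

lemma slot_tr_cong_op:
  assumes "\<And>x y. x \<in> idx d n \<Longrightarrow> y \<in> idx d n \<Longrightarrow> X x y = Y x y"
  shows "slot_tr d n X f = slot_tr d n Y f"
  unfolding slot_tr_def using assms by (intro sum.cong refl) simp

lemma slot_tr_product:
  "slot_tr d n (\<lambda>x y. \<Prod>k<n. \<sigma> k (x ! k) (y ! k)) f = (\<Prod>k<n. tr_prod d (\<sigma> k) (f k))"
proof -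
  have "slot_tr d n (\<lambda>x y. \<Prod>k<n. \<sigma> k (x ! k) (y ! k)) f
      = (\<Sum>x\<in>idx d n. \<Sum>y\<in>idx d n. \<Prod>k<n. \<sigma> k (x ! k) (y ! k) * f k (y ! k) (x ! k))"
    by (simp add: slot_tr_def prod.distrib)
  also have "\<dots> = (\<Sum>x\<in>idx d n. \<Prod>k<n. \<Sum>b<d. \<sigma> k (x ! k) b * f k b (x ! k))"
    by (intro sum.cong refl sum_idx_prod)
  also have "\<dots> = (\<Prod>k<n. tr_prod d (\<sigma> k) (f k))"
    unfolding tr_prod_def by (rule sum_idx_prod)
  finally show ?thesis .
qed

lemma slot_tr_linear:
  "slot_tr d n (\<lambda>x y. \<Sum>l\<in>L. c l * X l x y) f = (\<Sum>l\<in>L. c l * slot_tr d n (X l) f)"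
proof -
  have "(\<Sum>l\<in>L. c l * slot_tr d n (X l) f)
      = (\<Sum>x\<in>idx d n. \<Sum>y\<in>idx d n. \<Sum>l\<in>L. c l * (X l x y * (\<Prod>k<n. f k (y ! k) (x ! k))))"
    unfolding slot_tr_def sum_distrib_left
    by (subst sum.swap, intro sum.cong refl, subst sum.swap) simp
  then show ?thesis
    by (simp add: slot_tr_def sum_distrib_right mult.assoc)
qed

text \<open>Multilinearity. When the \<open>F k j\<close> are outcomes of measurements on the slots,
  it writes a product observable as the mean of \<open>\<Prod>k<n. c k (s k)\<close> over outcome
  strings \<open>s\<close>.\<close>

lemma slot_tr_expand:
  assumes "finite J"
  shows "slot_tr d n X (\<lambda>k x y. \<Sum>j\<in>J. c k j * F k j x y)
    = (\<Sum>s\<in>PiE {..<n} (\<lambda>_. J). (\<Prod>k<n. c k (s k)) * slot_tr d n X (\<lambda>k. F k (s k)))"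
proof -
  have "slot_tr d n X (\<lambda>k x y. \<Sum>j\<in>J. c k j * F k j x y)
    = (\<Sum>x\<in>idx d n. \<Sum>y\<in>idx d n. \<Sum>s\<in>PiE {..<n} (\<lambda>_. J).
        (\<Prod>k<n. c k (s k)) * (X x y * (\<Prod>k<n. F k (s k) (y ! k) (x ! k))))"
    unfolding slot_tr_def using assms
    by (subst prod_sum_PiE) (auto simp: sum_distrib_left prod.distrib mult_ac)
  also have "\<dots> = (\<Sum>x\<in>idx d n. \<Sum>s\<in>PiE {..<n} (\<lambda>_. J). \<Sum>y\<in>idx d n.
        (\<Prod>k<n. c k (s k)) * (X x y * (\<Prod>k<n. F k (s k) (y ! k) (x ! k))))"
    by (intro sum.cong refl sum.swap)
  also have "\<dots> = (\<Sum>s\<in>PiE {..<n} (\<lambda>_. J). (\<Prod>k<n. c k (s k)) * slot_tr d n X (\<lambda>k. F k (s k)))"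
    unfolding slot_tr_def sum_distrib_left by (rule sum.swap)
  finally show ?thesis .
qed

lemma ins_at_nth:
  "length u = n - 1 \<Longrightarrow> i < n \<Longrightarrow> k < n \<Longrightarrow>
    ins_at i a u ! k = (if k < i then u ! k else if k = i then a else u ! (k - 1))"
  by (auto simp: ins_at_def nth_append nth_Cons' intro!: arg_cong[where f = "(!) u"])

lemma bij_betw_ins_at:
  assumes "i < n"
  shows "bij_betw (\<lambda>(a, u). ins_at i a u) ({..<d} \<times> idx d (n - 1)) (idx d n)"
proof (rule bij_betw_byWitness[where f' = "\<lambda>x. (x ! i, take i x @ drop (Suc i) x)"])
  show "\<forall>p\<in>{..<d} \<times> idx d (n - 1). (\<lambda>x. (x ! i, take i x @ drop (Suc i) x)) ((\<lambda>(a, u). ins_at i a u) p) = p"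
    using assms by (auto simp: ins_at_def idx_def nth_append min_def)
  show "\<forall>x\<in>idx d n. (\<lambda>(a, u). ins_at i a u) (x ! i, take i x @ drop (Suc i) x) = x"
    using assms by (auto simp: ins_at_def idx_def min_def id_take_nth_drop[symmetric])
  show "(\<lambda>(a, u). ins_at i a u) ` ({..<d} \<times> idx d (n - 1)) \<subseteq> idx d n"
    using assms unfolding idx_def ins_at_def by (auto dest!: in_set_takeD in_set_dropD)
  show "(\<lambda>x. (x ! i, take i x @ drop (Suc i) x)) ` idx d n \<subseteq> {..<d} \<times> idx d (n - 1)"
    using assms idx_nth_less[of _ d n i] unfolding idx_def by (auto dest!: in_set_takeD in_set_dropD)
qed

text \<open>Identities in the other slots force the remaining indices to agree, which is the partial
  trace. Marginals thus become product observables.\<close>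

lemma tr_prod_ptrace_compl:
  assumes i: "i < n"
  shows "tr_prod d E (ptrace_compl d n i X) = slot_tr d n X (\<lambda>k. if k = i then E else identity d)"
proof -
  have prod: "(\<Prod>k<n. (if k = i then E else identity d) (ins_at i b w ! k) (ins_at i a u ! k))
      = (if w = u then E b a else 0)"
    if u: "u \<in> idx d (n - 1)" and w: "w \<in> idx d (n - 1)" for a b u w
  proof -
    have len: "length u = n - 1" "length w = n - 1" using u w by (auto simp: idx_def)
    have "(\<Prod>k<n. (if k = i then E else identity d) (ins_at i b w ! k) (ins_at i a u ! k))
      = E b a * (\<Prod>k\<in>{..<n} - {i}. identity d (ins_at i b w ! k) (ins_at i a u ! k))"
      using i len by (subst prod.remove[of _ i]) (auto simp: ins_at_nth[of _ n])
    also have "(\<Prod>k\<in>{..<n} - {i}. identity d (ins_at i b w ! k) (ins_at i a u ! k)) = (if w = u then 1 else 0)"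
    proof (cases "w = u")
      case True
      have "identity d (ins_at i b w ! k) (ins_at i a u ! k) = 1" if "k < n" "k \<noteq> i" for k
        using that i len True idx_nth_less[OF u, of k] idx_nth_less[OF u, of "k - 1"]
        by (auto simp: ins_at_nth[of _ n] identity_def)
      then show ?thesis using True by simp
    next
      case False
      then obtain j where j: "j < n - 1" "w ! j \<noteq> u ! j" using len nth_equalityI by metis
      \<comment> \<open>Position in the full multi-index of entry \<open>j\<close> of the reduced
        one.\<close>
      define k where "k = (if j < i then j else Suc j)"
      have "k \<in> {..<n} - {i}" using j by (auto simp: k_def)
      moreover have "identity d (ins_at i b w ! k) (ins_at i a u ! k) = 0"
        using j i len by (auto simp: ins_at_nth[of _ n] identity_def k_def)
      ultimately show ?thesis using False by (auto intro!: prod_zero)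
    qed
    finally show ?thesis by simp
  qed
  have re: "(\<Sum>x\<in>idx d n. g x) = (\<Sum>a<d. \<Sum>u\<in>idx d (n - 1). g (ins_at i a u))" for g :: "nat list \<Rightarrow> complex"
    using sum.reindex_bij_betw[OF bij_betw_ins_at[OF i], of g d]
    by (simp add: sum.cartesian_product case_prod_beta)
  have "slot_tr d n X (\<lambda>k. if k = i then E else identity d)
      = (\<Sum>a<d. \<Sum>u\<in>idx d (n - 1). \<Sum>b<d. \<Sum>w\<in>idx d (n - 1).
          X (ins_at i a u) (ins_at i b w) * (if w = u then E b a else 0))"
    unfolding slot_tr_def re by (intro sum.cong refl arg_cong2[where f = "(*)"] prod) auto
  also have "\<dots> = (\<Sum>a<d. \<Sum>u\<in>idx d (n - 1). \<Sum>b<d. X (ins_at i a u) (ins_at i b u) * E b a)"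
    by (simp add: if_distrib[of "(*) _"] cong: if_cong)
  also have "\<dots> = (\<Sum>a<d. \<Sum>b<d. \<Sum>u\<in>idx d (n - 1). X (ins_at i a u) (ins_at i b u) * E b a)"
    by (intro sum.cong refl sum.swap)
  also have "\<dots> = tr_prod d E (ptrace_compl d n i X)"
    unfolding tr_prod_def ptrace_compl_def
    by (subst sum.swap) (auto simp: sum_distrib_left mult_ac intro!: sum.cong)
  finally show ?thesis by simp
qed

lemma tr_prod_commute: "tr_prod d X Y = tr_prod d Y X"
  unfolding tr_prod_def by (subst sum.swap) (simp add: mult.commute)

lemma tr_prod_sum_left:
  "tr_prod d (\<lambda>x y. \<Sum>l\<in>L. c l * X l x y) Y = (\<Sum>l\<in>L. c l * tr_prod d (X l) Y)"
proof -
  have "(\<Sum>l\<in>L. c l * tr_prod d (X l) Y) = (\<Sum>x<d. \<Sum>y<d. \<Sum>l\<in>L. c l * (X l x y * Y y x))"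
    unfolding tr_prod_def sum_distrib_left
    by (subst sum.swap, intro sum.cong refl, subst sum.swap) simp
  then show ?thesis by (simp add: tr_prod_def sum_distrib_right mult.assoc)
qed

lemma tr_prod_sum_right:
  "tr_prod d Y (\<lambda>x y. \<Sum>l\<in>L. c l * X l x y) = (\<Sum>l\<in>L. c l * tr_prod d Y (X l))"
  by (subst (1 2) tr_prod_commute) (rule tr_prod_sum_left)

lemma tr_prod_identity: "tr_prod d X (identity d) = mtrace d X"
  by (simp add: tr_prod_def identity_def mtrace_def if_distrib[of "(*) _"] cong: if_cong)

lemma slot_tr_identity: "slot_tr d n X (\<lambda>_. identity d) = ttrace d n X"
proof -
  have "(\<Prod>k<n. identity d (y ! k) (x ! k)) = (if y = x then 1 else 0)"
    if "x \<in> idx d n" "y \<in> idx d n" for x y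
  proof (cases "y = x")
    case True
    then show ?thesis using that by (auto simp: identity_def idx_nth_less)
  next
    case False
    have "length x = n" "length y = n" using that by (auto simp: idx_def)
    then obtain k where "k < n" "y ! k \<noteq> x ! k" using False nth_equalityI[of y x] by auto
    then show ?thesis using False by (auto simp: identity_def intro!: prod_zero)
  qed
  then have "slot_tr d n X (\<lambda>_. identity d) = (\<Sum>x\<in>idx d n. \<Sum>y\<in>idx d n. X x y * (if y = x then 1 else 0))"
    unfolding slot_tr_def by (intro sum.cong refl arg_cong2[where f = "(*)"]) auto
  then show ?thesis by (simp add: ttrace_def if_distrib[of "(*) _"] cong: if_cong)
qed

section \<open>Positive semidefinite matrices and real coordinates\<close>

lemma psd_diag:
  assumes "psd d M" "k < d"
  shows "0 \<le> M k k"
proof -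
  define v :: "nat \<Rightarrow> complex" where "v i = (if i = k then 1 else 0)" for i
  have "cnj (v i) * M i j * v j = (if i = k then if j = k then M i j else 0 else 0)" for i j
    by (simp add: v_def)
  then have eq: "(\<Sum>i<d. \<Sum>j<d. cnj (v i) * M i j * v j) = M k k"
    using assms(2) by (simp add: sum.If_cases)
  have "0 \<le> (\<Sum>i<d. \<Sum>j<d. cnj (v i) * M i j * v j)"
    using assms(1) unfolding psd_def by blast
  then show ?thesis unfolding eq .
qed

text \<open>Polarisation: the form is real at the vectors with entry 1 at \<open>x\<close> and
  \<open>z\<close> at \<open>y\<close>. Taking \<open>z = 1\<close> compares imaginary parts of the
  two entries, \<open>z = \<i>\<close> their real parts.\<close>

lemma psd_hermitian:
  assumes "psd d M"
  shows "M x y = cnj (M y x)"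
proof (cases "x < d \<and> y < d")
  case False
  then show ?thesis using assms unfolding psd_def supported_def
    by (metis complex_cnj_zero)
next
  case True
  have two: "0 \<le> M x x + M x y * z + cnj z * M y x + cnj z * z * M y y" if "x \<noteq> y" for z
  proof -
    define v where "v k = (if k = x then 1 else 0) + (if k = y then z else 0)" for k
    have row: "(\<Sum>j<d. g j * v j) = g x + g y * z" for g
      using True by (simp add: v_def distrib_left sum.distrib if_distrib[of "(*) _"] cong: if_cong)
    have col: "(\<Sum>i<d. cnj (v i) * g i) = g x + cnj z * g y" for g
    proof -
      have "cnj (v i) * g i = (if i = x then g i else 0) + (if i = y then cnj z * g i else 0)" for i
        by (simp add: v_def distrib_right)
      then show ?thesis using True by (simp add: sum.distrib)
    qed
    have "(\<Sum>i<d. \<Sum>j<d. cnj (v i) * M i j * v j) = (\<Sum>i<d. cnj (v i) * (\<Sum>j<d. M i j * v j))"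
      by (simp add: sum_distrib_left mult.assoc)
    also have "\<dots> = M x x + M x y * z + cnj z * (M y x + M y y * z)"
      by (simp add: row col)
    finally have eq: "(\<Sum>i<d. \<Sum>j<d. cnj (v i) * M i j * v j)
        = M x x + M x y * z + cnj z * M y x + cnj z * z * M y y" by (simp add: algebra_simps)
    have "0 \<le> (\<Sum>i<d. \<Sum>j<d. cnj (v i) * M i j * v j)"
      using assms unfolding psd_def by blast
    then show ?thesis unfolding eq .
  qed
  have d: "Im (M x x) = 0" "Im (M y y) = 0"
    using psd_diag[OF assms] True by (auto simp: less_eq_complex_def)
  show ?thesis
  proof (cases "x = y")
    case True
    then show ?thesis using d by (simp add: complex_eq_iff)
  next
    case False
    show ?thesis using two[OF False, of 1] two[OF False, of \<i>] d
      by (simp add: less_eq_complex_def complex_eq_iff)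
  qed
qed

text \<open>The coordinates are real because \<open>v\<close> and the \<open>b j\<close> are
  Hermitian: taking adjoints in the expansion conjugates the coefficients, and pairing with the dual
  basis shows that they are unchanged.\<close>

lemma psd_dual_basis:
  assumes psd: "\<And>v. v \<in> V \<Longrightarrow> psd d v"
    and v0: "v0 \<in> V" "v0 x0 y0 \<noteq> 0"
  obtains m :: nat and b D and e :: "cmat \<Rightarrow> nat \<Rightarrow> real" where "0 < m" "b 0 = v0"
    "\<And>j. j < m \<Longrightarrow> b j \<in> V" "\<And>j. supported d (D j)"
    "\<And>j k. j < m \<Longrightarrow> k < m \<Longrightarrow> e (b j) k = (if j = k then 1 else 0)"
    "\<And>v j. v \<in> V \<Longrightarrow> j < m \<Longrightarrow> tr_prod d v (D j) = complex_of_real (e v j)"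
    "\<And>v. v \<in> V \<Longrightarrow> v = (\<lambda>x y. \<Sum>j<m. complex_of_real (e v j) * b j x y)"
proof -
  have sup: "supported d v" and herm: "v x y = cnj (v y x)" if "v \<in> V" for v x y
    using psd[OF that] psd_hermitian psd_def by blast+
  define J where "J = {..<d} \<times> {..<d}"
  have fin: "finite J" and xJ: "(x0, y0) \<in> J"
    using sup[OF v0(1)] v0(2) unfolding J_def supported_def by auto
  have c0: "case_prod v0 \<in> case_prod ` V" "case_prod v0 (x0, y0) \<noteq> 0" using v0 by auto
  obtain m :: nat and b' D' where *: "0 < m" "b' 0 = case_prod v0"
    "\<And>j. j < m \<Longrightarrow> b' j \<in> case_prod ` V"
    "\<And>j k. j < m \<Longrightarrow> k < m \<Longrightarrow> (\<Sum>y\<in>J. b' j y * D' k y) = (if j = k then 1 else 0)"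
    "\<And>v x. v \<in> case_prod ` V \<Longrightarrow> x \<in> J \<Longrightarrow> v x = (\<Sum>j<m. (\<Sum>y\<in>J. v y * D' j y) * b' j x)"
    using exists_dual_basis[OF fin c0(1) xJ c0(2)] by blast
  define b where "b j = curry (b' j)" for j
  \<comment> \<open>Transposed, because \<open>tr_prod\<close> pairs entry \<open>(x, y)\<close> of
    one factor with \<open>(y, x)\<close> of the other.\<close>
  define D where "D j = (\<lambda>y x. if y < d \<and> x < d then D' j (x, y) else 0)" for j
  define e where "e v j = Re (tr_prod d v (D j))" for v j
  have tr: "tr_prod d v (D j) = (\<Sum>y\<in>J. case_prod v y * D' j y)" for v j
    unfolding tr_prod_def J_def sum.cartesian_product by (intro sum.cong) (auto simp: D_def)
  have bV: "b j \<in> V" if "j < m" for j using *(3)[OF that] by (auto simp: b_def)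
  have rep: "v x y = (\<Sum>j<m. tr_prod d v (D j) * b j x y)" if v: "v \<in> V" for v x y
  proof (cases "x < d \<and> y < d")
    case True
    then show ?thesis using *(5)[of "case_prod v" "(x, y)"] v by (simp add: tr J_def b_def curry_def)
  next
    case False
    then have "v x y = 0" "\<And>j. j < m \<Longrightarrow> b j x y = 0" using sup v bV unfolding supported_def by blast+
    then show ?thesis by simp
  qed
  have dual: "tr_prod d (b j) (D k) = (if j = k then 1 else 0)" if "j < m" "k < m" for j k
    using *(4)[OF that] by (simp add: tr b_def)
  have real: "tr_prod d v (D j) = complex_of_real (e v j)" if v: "v \<in> V" and j: "j < m" for v j
  proof -
    have "v x y = (\<Sum>k<m. cnj (tr_prod d v (D k)) * b k x y)" for x y
    proof -
      have "v x y = cnj (v y x)" using herm v by blast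
      also have "\<dots> = (\<Sum>k<m. cnj (tr_prod d v (D k)) * cnj (b k y x))"
        by (subst rep[OF v]) simp
      also have "\<dots> = (\<Sum>k<m. cnj (tr_prod d v (D k)) * b k x y)"
      proof (rule sum.cong[OF refl])
        fix k assume "k \<in> {..<m}"
        then have "cnj (b k y x) = b k x y" using herm[OF bV, of k x y] by simp
        then show "cnj (tr_prod d v (D k)) * cnj (b k y x) = cnj (tr_prod d v (D k)) * b k x y" by simp
      qed
      finally show ?thesis .
    qed
    then have "tr_prod d v (D j) = tr_prod d (\<lambda>x y. \<Sum>k<m. cnj (tr_prod d v (D k)) * b k x y) (D j)"
      by (intro arg_cong2[where f = "tr_prod d"]) auto
    also have "\<dots> = (\<Sum>k<m. cnj (tr_prod d v (D k)) * (if k = j then 1 else 0))"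
      unfolding tr_prod_sum_left using j by (intro sum.cong) (auto simp: dual)
    also have "\<dots> = cnj (tr_prod d v (D j))" using j by (simp add: if_distrib[of "(*) _"] cong: if_cong)
    finally show ?thesis by (simp add: e_def complex_eq_iff)
  qed
  show thesis
  proof (rule that[of m b D e])
    show "b 0 = v0" by (simp add: b_def *(2))
    show "supported d (D j)" for j by (simp add: supported_def D_def)
    show "e (b j) k = (if j = k then 1 else 0)" if "j < m" "k < m" for j k
      using dual[OF that] by (simp add: e_def)
    show "v = (\<lambda>x y. \<Sum>j<m. complex_of_real (e v j) * b j x y)" if "v \<in> V" for v
      using rep[OF that] real[OF that] by (intro ext) (metis (no_types, lifting) lessThan_iff sum.cong)
  qed (use *(1) bV real in auto)
qed


subsection \<open>Measure and prepare\<close>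

lemma noncontextual_imp_pseudo_broadcastable:
  assumes nc: "mp_noncontextual d T A" and states: "\<And>\<rho>. \<rho> \<in> T \<Longrightarrow> is_state d \<rho>"
    and n: "n \<ge> 1"
  shows "pseudo_broadcastable d n T A"
proof -
  from nc obtain k :: nat and G \<sigma> where nc':
    "\<forall>\<rho>\<in>T. \<forall>E\<in>A. tr_prod d \<rho> E = (\<Sum>l<k. tr_prod d \<rho> (G l) * tr_prod d (\<sigma> l) E)"
    "\<forall>\<rho>\<in>T. (\<forall>l<k. 0 \<le> tr_prod d \<rho> (G l)) \<and> (\<Sum>l<k. tr_prod d \<rho> (G l)) = 1"
    "\<forall>l<k. (\<forall>E\<in>A. 0 \<le> tr_prod d (\<sigma> l) E) \<and> mtrace d (\<sigma> l) = 1"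
    unfolding mp_noncontextual_def by (elim exE conjE)
  have dec: "tr_prod d \<rho> E = (\<Sum>l<k. tr_prod d \<rho> (G l) * tr_prod d (\<sigma> l) E)"
    if "\<rho> \<in> T" "E \<in> A" for \<rho> E using nc'(1) that by simp
  have Gpos: "0 \<le> tr_prod d \<rho> (G l)" if "\<rho> \<in> T" "l < k" for \<rho> l using nc'(2) that by simp
  have Gsum: "(\<Sum>l<k. tr_prod d \<rho> (G l)) = 1" if "\<rho> \<in> T" for \<rho> using nc'(2) that by simp
  have spos: "0 \<le> tr_prod d (\<sigma> l) E" if "l < k" "E \<in> A" for l E using nc'(3) that by simp
  have str: "mtrace d (\<sigma> l) = 1" if "l < k" for l using nc'(3) that by simp
  \<comment> \<open>Outside the span of \<open>T\<close> the functionals \<open>tr[X G_l]\<close> need not add up to \<open>tr X\<close>;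
    the extra term \<open>l = k\<close> restores trace preservation and vanishes on \<open>T\<close>.\<close>
  define c where "c X l = (if l < k then tr_prod d X (G l) else mtrace d X - (\<Sum>l<k. tr_prod d X (G l)))" for X l
  define \<sigma>' where "\<sigma>' l = (if l < k then \<sigma> l else (\<lambda>i j. if i = 0 \<and> j = 0 then 1 else 0))" for l
  define \<Xi> where "\<Xi> X = (\<lambda>x y. \<Sum>l\<le>k. c X l * (\<Prod>i<n. \<sigma>' l (x ! i) (y ! i)))" for X
  have slot: "slot_tr d n (\<Xi> X) f = (\<Sum>l\<le>k. c X l * (\<Prod>i<n. tr_prod d (\<sigma>' l) (f i)))" for X f
    unfolding \<Xi>_def slot_tr_linear slot_tr_product[of d n "\<lambda>_. \<sigma>' _"] ..
  have slot_T: "slot_tr d n (\<Xi> \<rho>) f = (\<Sum>l<k. tr_prod d \<rho> (G l) * (\<Prod>i<n. tr_prod d (\<sigma> l) (f i)))"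
    if "\<rho> \<in> T" for \<rho> f
  proof -
    have "c \<rho> k = 0" using states[OF that] Gsum[OF that] by (simp add: c_def is_state_def)
    then show ?thesis by (simp add: slot lessThan_Suc_atMost[symmetric]) (simp add: c_def \<sigma>'_def)
  qed
  have trp: "tr_prod d (\<lambda>i j. a * X i j + b * Y i j) Z = a * tr_prod d X Z + b * tr_prod d Y Z" for a b X Y Z
    by (simp add: tr_prod_def sum_distrib_left sum.distrib distrib_right mult.assoc)
  have mtr: "mtrace d (\<lambda>i j. a * X i j + b * Y i j) = a * mtrace d X + b * mtrace d Y" for a b X Y
    by (simp add: mtrace_def sum_distrib_left sum.distrib)
  have clin: "c (\<lambda>i j. a * X i j + b * Y i j) l = a * c X l + b * c Y l" for a b X Y l
    by (simp add: c_def trp mtr sum.distrib sum_distrib_left algebra_simps)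
  show ?thesis
    unfolding pseudo_broadcastable_def
  proof (intro exI[of _ \<Xi>] conjI allI impI ballI)
    show "\<Xi> (\<lambda>i j. a * X i j + b * Y i j) x y = a * \<Xi> X x y + b * \<Xi> Y x y" for a b X Y x y
      unfolding \<Xi>_def clin by (simp add: sum_distrib_left sum.distrib distrib_right mult.assoc)
    show "ttrace d n (\<Xi> X) = mtrace d X" for X
    \<comment> \<open>The matrix unit used for the extra term has trace 1 only if
      \<open>d > 0\<close>. For \<open>d = 0\<close> and \<open>n \<ge> 1\<close> there are no
      multi-indices, and both traces are 0.\<close>
    proof (cases "d = 0")
      case True
      then show ?thesis using n by (cases n) (auto simp: ttrace_def mtrace_def idx_Suc)
    next
      case False
      have "tr_prod d (\<sigma>' l) (identity d) = 1" for l
      proof (cases "l < k")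
        case True then show ?thesis by (simp add: tr_prod_identity \<sigma>'_def str)
      next
        case l: False
        have "mtrace d (\<sigma>' l) = (\<Sum>i<d. if i = 0 then 1 else 0)" using l by (simp add: mtrace_def \<sigma>'_def)
        then show ?thesis using False by (simp add: tr_prod_identity)
      qed
      then have "ttrace d n (\<Xi> X) = (\<Sum>l\<le>k. c X l)"
        by (simp add: slot_tr_identity[symmetric] slot)
      then show ?thesis by (simp add: lessThan_Suc_atMost[symmetric]) (simp add: c_def)
    qed
    show "tr_prod d E (ptrace_compl d n i (\<Xi> \<rho>)) = tr_prod d E \<rho>"
      if i: "i < n" and \<rho>: "\<rho> \<in> T" and E: "E \<in> A" for i \<rho> E
    proof -
      have "(\<Prod>j<n. tr_prod d (\<sigma> l) (if j = i then E else identity d)) = tr_prod d (\<sigma> l) E" if "l < k" for l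
      proof -
        have "(\<Prod>j<n. tr_prod d (\<sigma> l) (if j = i then E else identity d))
            = (\<Prod>j<n. if j = i then tr_prod d (\<sigma> l) E else 1)"
          using str[OF that] by (intro prod.cong) (auto simp: tr_prod_identity)
        then show ?thesis using i by simp
      qed
      then show ?thesis
        by (simp add: tr_prod_ptrace_compl[OF i] slot_T[OF \<rho>] tr_prod_commute[of d E \<rho>] dec[OF \<rho> E])
    qed
    show "0 \<le> ttr_prod d n (\<Xi> \<rho>) (tensor As)"
      if \<rho>: "\<rho> \<in> T" and As: "length As = n" "set As \<subseteq> A" for \<rho> As
    proof -
      have "0 \<le> (\<Prod>i<N. tr_prod d (\<sigma> l) (As ! i))" if "N \<le> n" "l < k" for N l
        using that(1)
      proof (induction N)
        case (Suc N)
        then have "As ! N \<in> A" using As by auto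
        then show ?case using Suc spos[OF that(2)] by (auto intro!: mult_nonneg_nonneg)
      qed (simp add: less_eq_complex_def)
      then show ?thesis
        unfolding ttr_prod_tensor[OF As(1)] slot_T[OF \<rho>]
        using Gpos[OF \<rho>] by (intro sum_nonneg mult_nonneg_nonneg) auto
    qed
  qed
qed

subsection \<open>Empirical functionals on many copies\<close>

text \<open>Bounds a product of weights near 1 below by the exponential of their first-order sum, up
  to a quadratic loss.\<close>

lemma exp_le_one_plus:
  fixes x :: real
  assumes "\<bar>x\<bar> \<le> 1 / 2"
  shows "exp (x - 2 * x\<^sup>2) \<le> 1 + x"
proof -
  have "x - 2 * x\<^sup>2 \<le> ln (1 + x)" using abs_ln_one_plus_x_minus_x_bound[OF assms] by linarith
  then have "exp (x - 2 * x\<^sup>2) \<le> exp (ln (1 + x))" by simp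
  then show ?thesis using assms by simp
qed

lemma sum_UN_le:
  fixes f :: "'b \<Rightarrow> real"
  assumes "finite I" "\<And>i. i \<in> I \<Longrightarrow> finite (B i)" "\<And>i x. i \<in> I \<Longrightarrow> x \<in> B i \<Longrightarrow> 0 \<le> f x"
  shows "sum f (\<Union>i\<in>I. B i) \<le> (\<Sum>i\<in>I. sum f (B i))"
  using assms
proof (induction I rule: finite_induct)
  case (insert i I)
  have "sum f (B i \<union> (\<Union>i\<in>I. B i)) \<le> sum f (B i) + sum f (\<Union>i\<in>I. B i)"
    using insert.prems insert.hyps by (subst sum.union_inter[symmetric]) (auto intro!: sum_nonneg)
  then show ?case using insert by fastforce
qed simp

lemma exists_exp_small:
  fixes K \<kappa> \<delta> :: real
  assumes "0 \<le> K" "0 < \<kappa>" "0 < \<delta>"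
  obtains n :: nat where "1 \<le> n" "K * exp (- real n * \<kappa>) \<le> \<delta>"
proof -
  obtain n0 :: nat where n0: "K / (\<kappa> * \<delta>) < real n0" using reals_Archimedean2 by blast
  define n where "n = Suc n0"
  have "K / (\<kappa> * \<delta>) \<le> real n" using n0 by (simp add: n_def)
  then have "K \<le> \<delta> * (real n * \<kappa>)" using assms by (simp add: pos_divide_le_eq mult_ac)
  also have "\<dots> \<le> \<delta> * exp (real n * \<kappa>)"
    using assms exp_ge_add_one_self[of "real n * \<kappa>"] by (intro mult_left_mono) linarith+
  finally have "K * exp (- (real n * \<kappa>)) \<le> \<delta>"
    by (simp add: exp_minus divide_inverse[symmetric] pos_divide_le_eq)
  then show thesis using that[of n] unfolding n_def by (metis One_nat_def Suc_leI mult_minus_left zero_less_Suc)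
qed

lemma linear_op_sum:
  fixes \<Xi> :: "cmat \<Rightarrow> tmat"
  assumes lin: "\<And>a b X Y x y. supported d X \<Longrightarrow> supported d Y \<Longrightarrow> x \<in> idx d n \<Longrightarrow> y \<in> idx d n \<Longrightarrow>
      \<Xi> (\<lambda>i j. a * X i j + b * Y i j) x y = a * \<Xi> X x y + b * \<Xi> Y x y"
    and sup: "\<And>l. l < (r::nat) \<Longrightarrow> supported d (X l)" and xy: "x \<in> idx d n" "y \<in> idx d n"
  shows "\<Xi> (\<lambda>i j. \<Sum>l<r. c l * X l i j) x y = (\<Sum>l<r. c l * \<Xi> (X l) x y)"
  using sup
proof (induction r)
  case 0
  have "supported d (\<lambda>_ _. 0)" by (simp add: supported_def)
  from lin[OF this this xy, of 0 0] show ?case by simp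
next
  case (Suc r)
  have "supported d (\<lambda>i j. \<Sum>l<r. c l * X l i j)"
    unfolding supported_def
  proof (intro allI impI sum.neutral ballI)
    fix i j l assume "\<not> (i < d \<and> j < d)" "l \<in> {..<r}"
    then have "X l i j = 0" using Suc.prems[of l] by (simp add: supported_def)
    then show "c l * X l i j = 0" by simp
  qed
  from lin[OF this _ xy, of "X r" 1 "c r"] Suc show ?case by simp
qed

section \<open>Effect sets, product positivity and large deviations\<close>

locale effect_set =
  fixes d :: nat and A :: "cmat set"
  assumes effect: "E \<in> A \<Longrightarrow> is_effect d E"
    and convex: "convex_mats A"
    and identity_in: "identity d \<in> A"
    and compl_in: "E \<in> A \<Longrightarrow> (\<lambda>i j. identity d i j - E i j) \<in> A"
begin

lemma mix_in:
  "X \<in> A \<Longrightarrow> Y \<in> A \<Longrightarrow> 0 \<le> t \<Longrightarrow> t \<le> 1 \<Longrightarrow>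
    (\<lambda>i j. complex_of_real t * X i j + complex_of_real (1 - t) * Y i j) \<in> A"
  using convex unfolding convex_mats_def by blast

lemma zero_in: "(\<lambda>_ _. 0) \<in> A"
  using compl_in[OF identity_in] by simp

lemma scale_in:
  assumes "X \<in> A" "0 \<le> t" "t \<le> 1"
  shows "(\<lambda>i j. complex_of_real t * X i j) \<in> A"
  using mix_in[OF assms(1) zero_in assms(2,3)] by simp

lemma average_in:
  fixes m :: nat
  assumes "\<And>j. j < m \<Longrightarrow> B j \<in> A"
  shows "(\<lambda>x y. (\<Sum>j<m. B j x y) / of_nat m) \<in> A"
  using assms
proof (induction m)
  case 0
  then show ?case using zero_in by simp
next
  case (Suc m)
  define t where "t = real m / real (Suc m)"
  have t: "0 \<le> t" "t \<le> 1" by (auto simp: t_def)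
  have "complex_of_real t * ((\<Sum>j<m. B j x y) / of_nat m) + complex_of_real (1 - t) * B m x y
      = (\<Sum>j<Suc m. B j x y) / of_nat (Suc m)" for x y
  proof -
    have "complex_of_real t = of_nat m / of_nat (Suc m)" by (simp add: t_def)
    moreover have "complex_of_real (1 - t) = 1 / of_nat (Suc m)"
      by (simp add: t_def field_simps)
    ultimately show ?thesis by (cases "m = 0") (auto simp: add_divide_distrib)
  qed
  then show ?case using mix_in[OF Suc.IH Suc.prems[of m] t] Suc.prems by simp
qed

definition positive_on :: "nat \<Rightarrow> tmat \<Rightarrow> bool" where
  "positive_on n X \<longleftrightarrow> (\<forall>f. (\<forall>k<n. f k \<in> A) \<longrightarrow> 0 \<le> slot_tr d n X f)"

text \<open>Writing each identity as \<open>B + (I - B)\<close> and expanding gives nonnegative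
  terms, one of which has \<open>B\<close> in every slot.\<close>

lemma slot_tr_le_identity:
  assumes X: "positive_on n X" and B: "B \<in> A"
  shows "slot_tr d n X (\<lambda>_. B) \<le> slot_tr d n X (\<lambda>_. identity d)"
proof -
  define F where "F b = (if b then B else (\<lambda>i j. identity d i j - B i j))" for b :: bool
  define S where "S = PiE {..<n} (\<lambda>_. UNIV :: bool set)"
  define s1 where "s1 = (\<lambda>k\<in>{..<n}. True)"
  have F: "F b \<in> A" for b using B compl_in by (auto simp: F_def)
  have S: "finite S" "s1 \<in> S" by (auto simp: S_def s1_def intro!: finite_PiE)
  have "(\<lambda>x y. \<Sum>b\<in>UNIV. 1 * F b x y) = identity d" by (auto simp: UNIV_bool F_def)
  then have "slot_tr d n X (\<lambda>_. identity d) = (\<Sum>s\<in>S. slot_tr d n X (\<lambda>k. F (s k)))"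
    using slot_tr_expand[of UNIV d n X "\<lambda>_ _. 1" "\<lambda>_. F"] by (simp add: S_def)
  also have "\<dots> = slot_tr d n X (\<lambda>k. F (s1 k)) + (\<Sum>s\<in>S - {s1}. slot_tr d n X (\<lambda>k. F (s k)))"
    using S by (rule sum.remove)
  also have "\<dots> \<ge> slot_tr d n X (\<lambda>k. F (s1 k)) + 0"
    using X F unfolding positive_on_def by (intro add_left_mono sum_nonneg) auto
  also have "slot_tr d n X (\<lambda>k. F (s1 k)) = slot_tr d n X (\<lambda>_. B)"
    by (intro slot_tr_cong) (auto simp: s1_def F_def)
  finally show ?thesis by simp
qed

text \<open>The exponential moment is a product observable: with weights \<open>1 - t a_j\<close> in each slot it
  equals the value on \<open>(I - t E)\<otimes>\<dots>\<otimes>(I - t E)\<close>, which is at most 1 because \<open>I - t E\<close> is an effect.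
  No independence of the slots is required.\<close>

lemma chernoff_bound:
  fixes a :: "nat \<Rightarrow> real"
  assumes X: "positive_on n X" "slot_tr d n X (\<lambda>_. identity d) = 1"
    and F: "\<And>j. j < m \<Longrightarrow> F j \<in> A" and sumF: "\<And>x y. (\<Sum>j<m. F j x y) = identity d x y"
    and E: "E \<in> A" "\<And>x y. (\<Sum>j<m. complex_of_real (a j) * F j x y) = E x y"
    and a: "\<And>j. j < m \<Longrightarrow> \<bar>a j\<bar> \<le> C" "1 \<le> C" and \<delta>: "0 < \<delta>" "\<delta> \<le> 1"
  shows "(\<Sum>s | s \<in> PiE {..<n} (\<lambda>_. {..<m}) \<and> (\<Sum>k<n. a (s k)) < - \<delta> * n.
            Re (slot_tr d n X (\<lambda>k. F (s k)))) \<le> exp (- real n * (\<delta>\<^sup>2 / (8 * C\<^sup>2)))"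
proof -
  define S where "S = PiE {..<n} (\<lambda>_. {..<m})"
  define Bad where "Bad = {s\<in>S. (\<Sum>k<n. a (s k)) < - \<delta> * n}"
  \<comment> \<open>The maximiser of \<open>t * \<delta> - 2 * t\<^sup>2 * C\<^sup>2\<close>, the
    exponent gained per slot; the maximum is
    \<open>\<delta>\<^sup>2 / (8 * C\<^sup>2)\<close>.\<close>
  define t where "t = \<delta> / (4 * C\<^sup>2)"
  define p where "p s = Re (slot_tr d n X (\<lambda>k. F (s k)))" for s
  define w where "w s = (\<Prod>k<n. 1 - t * a (s k))" for s
  define K where "K = exp (real n * (\<delta>\<^sup>2 / (8 * C\<^sup>2)))"
  have finS: "finite S" by (auto simp: S_def intro!: finite_PiE)
  have sS: "s k < m" if "s \<in> S" "k < n" for s k using that by (auto simp: S_def PiE_def Pi_def)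
  have C2: "1 \<le> C\<^sup>2" "C \<le> C\<^sup>2" using a(2) mult_mono[of 1 C 1 C] mult_left_mono[of 1 C C]
    by (simp_all add: power2_eq_square)
  have t: "0 < t" "t \<le> 1" "t * C \<le> 1 / 2"
  proof -
    show "0 < t" using \<delta> a(2) by (simp add: t_def)
    show "t \<le> 1" using \<delta> C2 by (simp add: t_def divide_le_eq)
    have "\<delta> * C \<le> 1 * C\<^sup>2" using \<delta> a(2) C2 by (intro mult_mono) auto
    then show "t * C \<le> 1 / 2" using a(2) C2 by (simp add: t_def field_simps)
  qed
  have ta: "\<bar>t * a j\<bar> \<le> 1 / 2" if "j < m" for j
  proof -
    have "\<bar>t * a j\<bar> \<le> t * C" using a(1)[OF that] t by (simp add: abs_mult)
    then show ?thesis using t(3) by linarith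
  qed
  have p: "0 \<le> p s" if "s \<in> S" for s
  proof -
    have "0 \<le> slot_tr d n X (\<lambda>k. F (s k))"
      using X(1) F sS[OF that] by (auto simp: positive_on_def)
    then show ?thesis by (simp add: p_def less_eq_complex_def)
  qed
  have w: "0 \<le> w s" if "s \<in> S" for s
    unfolding w_def
  proof (intro prod_nonneg ballI)
    fix k assume "k \<in> {..<n}"
    then have "\<bar>t * a (s k)\<bar> \<le> 1 / 2" using ta sS[OF that] by auto
    then show "0 \<le> 1 - t * a (s k)" by linarith
  qed
  define R where "R = (\<lambda>x y. identity d x y - complex_of_real t * E x y)"
  have RA: "R \<in> A" using compl_in[OF scale_in[OF E(1), of t]] t by (simp add: R_def)
  have "(\<lambda>x y. \<Sum>j<m. complex_of_real (1 - t * a j) * F j x y) = R"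
  proof (intro ext)
    fix x y
    have "(\<Sum>j<m. complex_of_real (1 - t * a j) * F j x y)
        = (\<Sum>j<m. F j x y) - complex_of_real t * (\<Sum>j<m. complex_of_real (a j) * F j x y)"
      by (simp add: left_diff_distrib sum_subtractf sum_distrib_left mult.assoc)
    then show "(\<Sum>j<m. complex_of_real (1 - t * a j) * F j x y) = R x y"
      by (simp add: sumF E(2) R_def)
  qed
  then have "slot_tr d n X (\<lambda>_. R) = (\<Sum>s\<in>S. complex_of_real (w s) * slot_tr d n X (\<lambda>k. F (s k)))"
    using slot_tr_expand[of "{..<m}" d n X "\<lambda>_ j. complex_of_real (1 - t * a j)" "\<lambda>_. F"]
    by (simp add: S_def w_def)
  then have "(\<Sum>s\<in>S. w s * p s) = Re (slot_tr d n X (\<lambda>_. R))"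
    by (simp add: p_def)
  also have "\<dots> \<le> 1"
    using slot_tr_le_identity[OF X(1) RA] X(2) by (simp add: less_eq_complex_def)
  finally have total: "(\<Sum>s\<in>S. w s * p s) \<le> 1" .
  have Kw: "K \<le> w s" if "s \<in> Bad" for s
  proof -
    have s: "s \<in> S" "(\<Sum>k<n. a (s k)) < - \<delta> * n" using that by (auto simp: Bad_def)
    have "(\<Sum>k<n. 2 * (t * a (s k))\<^sup>2) \<le> (\<Sum>k<n. 2 * (t\<^sup>2 * C\<^sup>2))"
    proof (intro sum_mono mult_left_mono)
      fix k assume "k \<in> {..<n}"
      then have "(a (s k))\<^sup>2 \<le> C\<^sup>2" using a(1)[OF sS[OF s(1)]] a(2) by (intro power2_le_iff_abs_le[THEN iffD2]) auto
      then show "(t * a (s k))\<^sup>2 \<le> t\<^sup>2 * C\<^sup>2" by (simp add: power_mult_distrib mult_left_mono)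
    qed simp
    moreover have "t * (\<delta> * n) \<le> - (\<Sum>k<n. t * a (s k))"
      using s(2) t(1) mult_left_mono[of "\<delta> * n" "- (\<Sum>k<n. a (s k))" t] by (simp add: sum_distrib_left)
    ultimately have "t * (\<delta> * n) - n * (2 * (t\<^sup>2 * C\<^sup>2)) \<le> (\<Sum>k<n. - (t * a (s k)) - 2 * (- (t * a (s k)))\<^sup>2)"
      by (simp add: sum_subtractf sum_negf)
    moreover have "t * (\<delta> * n) - n * (2 * (t\<^sup>2 * C\<^sup>2)) = n * (\<delta>\<^sup>2 / (8 * C\<^sup>2))"
      using a(2) by (simp add: t_def field_simps power2_eq_square)
    ultimately have "K \<le> exp (\<Sum>k<n. - (t * a (s k)) - 2 * (- (t * a (s k)))\<^sup>2)"
      by (simp add: K_def)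
    also have "\<dots> = (\<Prod>k<n. exp (- (t * a (s k)) - 2 * (- (t * a (s k)))\<^sup>2))"
      by (rule exp_sum) simp
    also have "\<dots> \<le> w s"
      unfolding w_def
    proof (intro prod_mono conjI)
      fix k assume "k \<in> {..<n}"
      then show "exp (- (t * a (s k)) - 2 * (- (t * a (s k)))\<^sup>2) \<le> 1 - t * a (s k)"
        using exp_le_one_plus[of "- (t * a (s k))"] ta[OF sS[OF s(1)]] by simp
    qed simp
    finally show ?thesis .
  qed
  \<comment> \<open>Markov's inequality: \<open>w\<close> is nonnegative on \<open>S\<close>, at
    least \<open>K\<close> on \<open>Bad\<close>, and has mean at most 1.\<close>
  have "K * (\<Sum>s\<in>Bad. p s) \<le> (\<Sum>s\<in>Bad. w s * p s)"
    unfolding sum_distrib_left using Kw p by (intro sum_mono mult_right_mono) (auto simp: Bad_def)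
  also have "\<dots> \<le> (\<Sum>s\<in>S. w s * p s)"
    using finS p w by (intro sum_mono2) (auto simp: Bad_def)
  finally have "K * (\<Sum>s\<in>Bad. p s) \<le> 1" using total by linarith
  then have "(\<Sum>s\<in>Bad. p s) \<le> 1 / K" by (simp add: K_def pos_le_divide_eq mult.commute)
  also have "1 / K = exp (- real n * (\<delta>\<^sup>2 / (8 * C\<^sup>2)))"
    unfolding K_def mult_minus_left exp_minus by (rule inverse_eq_divide[symmetric])
  finally show ?thesis by (simp add: Bad_def S_def p_def)
qed

text \<open>\<open>b\<close> is a basis of the span of \<open>A\<close> with coordinates \<open>e\<close>, and \<open>F\<close> is a measurement from whose
  outcome statistics all effects are recovered: outcome \<open>u\<close> is assigned the value \<open>g u j\<close> of \<open>b j\<close>.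
  Here \<open>F_j = b_j / m\<close> for \<open>j \<ge> 1\<close>.\<close>

lemma informationally_complete_measurement:
  assumes d: "0 < d"
  obtains m :: nat and b D F and e :: "cmat \<Rightarrow> nat \<Rightarrow> real" and g :: "nat \<Rightarrow> nat \<Rightarrow> real"
  where "0 < m" "b 0 = identity d" "\<And>j. j < m \<Longrightarrow> b j \<in> A" "\<And>j. supported d (D j)"
    "\<And>j k. j < m \<Longrightarrow> k < m \<Longrightarrow> e (b j) k = (if j = k then 1 else 0)"
    "\<And>E j. E \<in> A \<Longrightarrow> j < m \<Longrightarrow> tr_prod d E (D j) = complex_of_real (e E j)"
    "\<And>E. E \<in> A \<Longrightarrow> E = (\<lambda>x y. \<Sum>j<m. complex_of_real (e E j) * b j x y)"
    "\<And>u. u < m \<Longrightarrow> F u \<in> A" "\<And>x y. (\<Sum>u<m. F u x y) = identity d x y"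
    "\<And>j x y. j < m \<Longrightarrow> (\<Sum>u<m. complex_of_real (g u j) * F u x y) = b j x y"
    "\<And>u j. 0 \<le> g u j \<and> g u j \<le> real m" "\<And>u. g u 0 = 1"
proof -
  have psd: "psd d E" if "E \<in> A" for E using effect[OF that] by (simp add: is_effect_def)
  have nz: "identity d 0 0 \<noteq> 0" using d by (simp add: identity_def)
  obtain m :: nat and b D and e :: "cmat \<Rightarrow> nat \<Rightarrow> real" where *: "0 < m" "b 0 = identity d"
    "\<And>j. j < m \<Longrightarrow> b j \<in> A" "\<And>j. supported d (D j)"
    "\<And>j k. j < m \<Longrightarrow> k < m \<Longrightarrow> e (b j) k = (if j = k then 1 else 0)"
    "\<And>E j. E \<in> A \<Longrightarrow> j < m \<Longrightarrow> tr_prod d E (D j) = complex_of_real (e E j)"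
    "\<And>E. E \<in> A \<Longrightarrow> E = (\<lambda>x y. \<Sum>j<m. complex_of_real (e E j) * b j x y)"
    by (rule psd_dual_basis[OF psd identity_in nz], assumption+) (rule that)
  \<comment> \<open>Zero replaces the unit effect, so \<open>F 0\<close> is the complement of an
    average of effects and absorbs exactly what the outcomes \<open>F u\<close> with
    \<open>u \<ge> 1\<close> leave over.\<close>
  define B where "B j = (if j = 0 then (\<lambda>_ _. 0) else b j)" for j
  define F where "F u = (if u = 0 then (\<lambda>x y. identity d x y - (\<Sum>j<m. B j x y) / of_nat m)
      else (\<lambda>x y. b u x y / of_nat m))" for u
  \<comment> \<open>The value \<open>m\<close> undoes the factor \<open>1 / m\<close> in
    \<open>F j\<close>; the constant value 1 recovers the identity from the sum of all
    outcomes.\<close>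
  define g :: "nat \<Rightarrow> nat \<Rightarrow> real" where "g u j = (if j = 0 then 1 else if u = j then real m else 0)" for u j
  have B: "B j \<in> A" if "j < m" for j using *(3)[OF that] zero_in by (simp add: B_def)
  have F: "F u \<in> A" if u: "u < m" for u
  proof (cases "u = 0")
    case True
    have "(\<lambda>x y. identity d x y - (\<Sum>j<m. B j x y) / of_nat m) \<in> A"
      by (rule compl_in) (rule average_in[OF B])
    then show ?thesis using True by (simp add: F_def)
  next
    case False
    have "(\<lambda>x y. complex_of_real (1 / real m) * b u x y) \<in> A"
      using *(1) by (intro scale_in *(3)[OF u]) (auto simp: divide_le_eq)
    then show ?thesis using False by (simp add: F_def)
  qed
  obtain m' where m': "m = Suc m'" using *(1) gr0_implies_Suc by blast
  have sumF: "(\<Sum>u<m. F u x y) = identity d x y" for x y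
  proof -
    have "(\<Sum>j<m. B j x y) = (\<Sum>u<m'. b (Suc u) x y)"
      unfolding m' sum.lessThan_Suc_shift by (simp add: B_def)
    moreover have "(\<Sum>u<m. F u x y) = F 0 x y + (\<Sum>u<m'. F (Suc u) x y)"
      unfolding m' by (rule sum.lessThan_Suc_shift)
    ultimately show ?thesis by (simp add: F_def sum_divide_distrib[symmetric])
  qed
  have rec: "(\<Sum>u<m. complex_of_real (g u j) * F u x y) = b j x y" if j: "j < m" for j x y
  proof (cases "j = 0")
    case True
    then show ?thesis using sumF by (simp add: g_def *(2))
  next
    case False
    have "(\<Sum>u<m. complex_of_real (g u j) * F u x y) = (\<Sum>u<m. if u = j then of_nat m * F j x y else 0)"
      using False by (intro sum.cong) (auto simp: g_def)
    then show ?thesis using j False by (simp add: F_def)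
  qed
  have "0 \<le> g u j \<and> g u j \<le> real m" for u j using *(1) by (auto simp: g_def)
  moreover have "g u 0 = 1" for u by (simp add: g_def)
  ultimately show thesis by (intro that[OF *(1-7) F sumF rec]) auto
qed

text \<open>Translates broadcasting into slot functionals. Linearity appears as expansion over the
  basis states, so positivity at every state of \<open>T\<close> becomes positivity on the
  coordinate vectors \<open>c \<rho>\<close>.\<close>

lemma pseudo_broadcastable_functional:
  fixes r :: nat
  assumes pb: "pseudo_broadcastable d n T A" and states: "\<And>\<rho>. \<rho> \<in> T \<Longrightarrow> is_state d \<rho>"
    and rb: "\<And>i. i < r \<Longrightarrow> rb i \<in> T"
    and rep: "\<And>\<rho>. \<rho> \<in> T \<Longrightarrow> \<rho> = (\<lambda>x y. \<Sum>i<r. complex_of_real (c \<rho> i) * rb i x y)"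
  obtains \<Xi> where "\<And>\<rho>. \<rho> \<in> T \<Longrightarrow> positive_on n (\<Xi> \<rho>)"
    "\<And>\<rho>. \<rho> \<in> T \<Longrightarrow> slot_tr d n (\<Xi> \<rho>) (\<lambda>_. identity d) = 1"
    "\<And>\<rho> k E. \<rho> \<in> T \<Longrightarrow> k < n \<Longrightarrow> E \<in> A \<Longrightarrow>
      slot_tr d n (\<Xi> \<rho>) (\<lambda>i. if i = k then E else identity d) = tr_prod d \<rho> E"
    "\<And>\<rho> f. \<rho> \<in> T \<Longrightarrow> slot_tr d n (\<Xi> \<rho>) f = (\<Sum>i<r. complex_of_real (c \<rho> i) * slot_tr d n (\<Xi> (rb i)) f)"
proof -
  from pb obtain \<Xi> where \<Xi>:
      "\<forall>a b X Y. supported d X \<longrightarrow> supported d Y \<longrightarrow>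
          (\<forall>x\<in>idx d n. \<forall>y\<in>idx d n.
             \<Xi> (\<lambda>i j. a * X i j + b * Y i j) x y = a * \<Xi> X x y + b * \<Xi> Y x y)"
      "\<forall>X. supported d X \<longrightarrow> ttrace d n (\<Xi> X) = mtrace d X"
      "\<forall>i<n. \<forall>\<rho>\<in>T. \<forall>E\<in>A. tr_prod d E (ptrace_compl d n i (\<Xi> \<rho>)) = tr_prod d E \<rho>"
      "\<forall>\<rho>\<in>T. \<forall>As. length As = n \<longrightarrow> set As \<subseteq> A \<longrightarrow> 0 \<le> ttr_prod d n (\<Xi> \<rho>) (tensor As)"
    unfolding pseudo_broadcastable_def by (elim exE conjE)
  have sup: "supported d \<rho>" if "\<rho> \<in> T" for \<rho>
    using states[OF that] by (simp add: is_state_def psd_def)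
  show thesis
  proof (rule that[of \<Xi>])
    fix \<rho> assume \<rho>: "\<rho> \<in> T"
    show "positive_on n (\<Xi> \<rho>)"
      unfolding positive_on_def
    proof (intro allI impI)
      fix f assume "\<forall>k<n. f k \<in> A"
      then have "set (map f [0..<n]) \<subseteq> A" by auto
      then have "0 \<le> ttr_prod d n (\<Xi> \<rho>) (tensor (map f [0..<n]))" using \<Xi>(4) \<rho> by simp
      then show "0 \<le> slot_tr d n (\<Xi> \<rho>) f" by (simp only: ttr_prod_tensor_map)
    qed
    show "slot_tr d n (\<Xi> \<rho>) (\<lambda>_. identity d) = 1"
      using \<Xi>(2) sup[OF \<rho>] states[OF \<rho>] by (simp add: slot_tr_identity is_state_def)
    show "slot_tr d n (\<Xi> \<rho>) (\<lambda>i. if i = k then E else identity d) = tr_prod d \<rho> E"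
      if "k < n" "E \<in> A" for k E
      using \<Xi>(3) that \<rho> by (simp add: tr_prod_ptrace_compl[symmetric] tr_prod_commute[of d \<rho>])
    fix f
    have "slot_tr d n (\<Xi> (\<lambda>x y. \<Sum>i<r. complex_of_real (c \<rho> i) * rb i x y)) f
        = slot_tr d n (\<lambda>x y. \<Sum>i<r. complex_of_real (c \<rho> i) * \<Xi> (rb i) x y) f"
    proof (rule slot_tr_cong_op)
      have lin: "\<Xi> (\<lambda>i j. a * X i j + b * Y i j) x y = a * \<Xi> X x y + b * \<Xi> Y x y"
        if "supported d X" "supported d Y" "x \<in> idx d n" "y \<in> idx d n" for a b X Y x y
        using \<Xi>(1) that by simp
      fix x y assume xy: "x \<in> idx d n" "y \<in> idx d n"
      show "\<Xi> (\<lambda>x y. \<Sum>i<r. complex_of_real (c \<rho> i) * rb i x y) x y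
          = (\<Sum>i<r. complex_of_real (c \<rho> i) * \<Xi> (rb i) x y)"
        using sup rb xy
        by (intro linear_op_sum[where \<Xi> = \<Xi> and d = d and n = n and X = rb and c = "\<lambda>i. complex_of_real (c \<rho> i)"] lin) auto
    qed
    then show "slot_tr d n (\<Xi> \<rho>) f = (\<Sum>i<r. complex_of_real (c \<rho> i) * slot_tr d n (\<Xi> (rb i)) f)"
      by (simp only: rep[OF \<rho>, symmetric] slot_tr_linear)
  qed
qed

text \<open>A string \<open>s\<close> of outcomes on the \<open>n\<close> copies defines the empirical functional with values
  \<open>q s j = (\<Sum>k<n. g (s k) j) / n\<close> on the basis. Averaged over \<open>s\<close> these reproduce the state exactly,
  because every copy has the right marginal. By the Chernoff bound the strings whose empirical functional
  is not almost positive carry little weight, and their functional may be replaced by an arbitrary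
  positive one, here \<open>E \<mapsto> E 0 0\<close>.\<close>

lemma approximate_separable_model:
  assumes pb: "\<And>n. n \<ge> 1 \<Longrightarrow> pseudo_broadcastable d n T A"
    and states: "\<And>\<rho>. \<rho> \<in> T \<Longrightarrow> is_state d \<rho>" and d: "0 < d"
    and rb: "\<And>i. i < r \<Longrightarrow> rb i \<in> T"
    and repT: "\<And>\<rho>. \<rho> \<in> T \<Longrightarrow> \<rho> = (\<lambda>x y. \<Sum>i<r. complex_of_real (c \<rho> i) * rb i x y)"
    and m: "0 < m" and b: "b 0 = identity d" "\<And>j. j < m \<Longrightarrow> b j \<in> A"
    and repA: "\<And>E. E \<in> A \<Longrightarrow> E = (\<lambda>x y. \<Sum>j<m. complex_of_real (e E j) * b j x y)"
    and F: "\<And>u. u < m \<Longrightarrow> F u \<in> A" "\<And>x y. (\<Sum>u<m. F u x y) = identity d x y"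
    and recover: "\<And>j x y. j < m \<Longrightarrow> (\<Sum>u<m. complex_of_real (g u j) * F u x y) = b j x y"
    and g: "\<And>u j. 0 \<le> g u j \<and> g u j \<le> real m" "\<And>u. g u 0 = 1"
    and B0: "finite B0" "B0 \<subseteq> A" and \<delta>: "0 < \<delta>"
  shows "\<exists>(S::(nat \<Rightarrow> nat) set) p q. finite S \<and> S \<noteq> {} \<and>
    separable_model r m (c ` T) (e ` B0) (\<lambda>i j. Re (tr_prod d (rb i) (b j))) \<delta> S p q \<and>
    (\<forall>s\<in>S. \<forall>j<m. 0 \<le> q s j \<and> q s j \<le> real m)"
proof -
  define a where "a E u = (\<Sum>j<m. e E j * g u j)" for E u
  define C where "C = 1 + (\<Sum>E\<in>B0. \<Sum>u<m. \<bar>a E u\<bar>)"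
  \<comment> \<open>The Chernoff bound is stated for deviations of at most 1.\<close>
  define \<eta> where "\<eta> = min \<delta> 1"
  define \<kappa> where "\<kappa> = \<eta>\<^sup>2 / (8 * C\<^sup>2)"
  have \<eta>: "0 < \<eta>" "\<eta> \<le> 1" "\<eta> \<le> \<delta>" using \<delta> by (auto simp: \<eta>_def)
  have C1: "1 \<le> C" by (auto simp: C_def intro!: sum_nonneg)
  have aC: "\<bar>a E u\<bar> \<le> C" if "E \<in> B0" "u < m" for E u
  proof -
    have "\<bar>a E u\<bar> \<le> (\<Sum>u<m. \<bar>a E u\<bar>)" using that by (intro member_le_sum) auto
    also have "\<dots> \<le> (\<Sum>E\<in>B0. \<Sum>u<m. \<bar>a E u\<bar>)"
      using that B0 by (intro member_le_sum[of E B0 "\<lambda>E. \<Sum>u<m. \<bar>a E u\<bar>"]) (auto intro!: sum_nonneg)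
    finally show ?thesis by (simp add: C_def)
  qed
  have \<kappa>: "0 < \<kappa>" using \<eta> C1 by (simp add: \<kappa>_def)
  \<comment> \<open>Replacing the bad functionals moves each value by at most \<open>m\<close> on a
    set of weight at most \<open>card B0 * exp (- real n * \<kappa>)\<close>; \<open>n\<close> makes
    the total effect at most \<open>\<delta>\<close>.\<close>
  obtain n :: nat where n: "1 \<le> n" "(real m * card B0) * exp (- real n * \<kappa>) \<le> \<delta>"
    using exists_exp_small[of "real m * card B0" \<kappa> \<delta>] \<kappa> \<delta> by auto
  obtain \<Xi> where pos: "\<And>\<rho>. \<rho> \<in> T \<Longrightarrow> positive_on n (\<Xi> \<rho>)"
    and norm: "\<And>\<rho>. \<rho> \<in> T \<Longrightarrow> slot_tr d n (\<Xi> \<rho>) (\<lambda>_. identity d) = 1"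
    and marg: "\<And>\<rho> k E. \<rho> \<in> T \<Longrightarrow> k < n \<Longrightarrow> E \<in> A \<Longrightarrow>
      slot_tr d n (\<Xi> \<rho>) (\<lambda>i. if i = k then E else identity d) = tr_prod d \<rho> E"
    and lin: "\<And>\<rho> f. \<rho> \<in> T \<Longrightarrow> slot_tr d n (\<Xi> \<rho>) f = (\<Sum>i<r. complex_of_real (c \<rho> i) * slot_tr d n (\<Xi> (rb i)) f)"
    by (rule pseudo_broadcastable_functional[OF pb[OF n(1)] states rb repT], assumption+) (rule that)
  define S where "S = PiE {..<n} (\<lambda>_. {..<m})"
  define P where "P \<rho> s = Re (slot_tr d n (\<Xi> \<rho>) (\<lambda>k. F (s k)))" for \<rho> s
  define q where "q s j = (\<Sum>k<n. g (s k) j) / n" for s j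
  define bad where "bad E = {s. s \<in> S \<and> (\<Sum>k<n. a E (s k)) < - \<eta> * n}" for E
  define Bad where "Bad = (\<Union>E\<in>B0. bad E)"
  define q' where "q' s j = (if s \<in> Bad then Re (b j 0 0) else q s j)" for s j
  have S: "finite S" "S \<noteq> {}" using m by (auto simp: S_def PiE_eq_empty_iff intro!: finite_PiE)
  have sS: "s k < m" if "s \<in> S" "k < n" for s k using that by (auto simp: S_def PiE_def Pi_def)
  have P: "0 \<le> P \<rho> s" if "\<rho> \<in> T" "s \<in> S" for \<rho> s
  proof -
    have "0 \<le> slot_tr d n (\<Xi> \<rho>) (\<lambda>k. F (s k))"
      using pos[OF that(1)] F(1) sS[OF that(2)] by (auto simp: positive_on_def)
    then show ?thesis by (simp add: P_def less_eq_complex_def)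
  qed
  have Bad: "Bad \<subseteq> S" by (auto simp: Bad_def bad_def)
  have q: "0 \<le> q s j \<and> q s j \<le> real m" for s j
  proof -
    have "(\<Sum>k<n. g (s k) j) \<le> (\<Sum>k<n. real m)" using g by (intro sum_mono) auto
    moreover have "0 \<le> (\<Sum>k<n. g (s k) j)" using g by (intro sum_nonneg) auto
    ultimately show ?thesis using n(1) by (auto simp: q_def divide_le_eq mult.commute)
  qed
  have b00: "0 \<le> Re (b j 0 0) \<and> Re (b j 0 0) \<le> 1" if "j < m" for j
    using effect[OF b(2)[OF that]] psd_diag[OF _ d]
    by (force simp: is_effect_def identity_def less_eq_complex_def d)
  have q': "0 \<le> q' s j \<and> q' s j \<le> real m" if "j < m" for s j
    using q[of s j] b00[OF that] m by (auto simp: q'_def)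
  have aF: "(\<Sum>u<m. complex_of_real (a E u) * F u x y) = E x y" if "E \<in> A" for E x y
  proof -
    have "(\<Sum>u<m. complex_of_real (a E u) * F u x y)
        = (\<Sum>u<m. \<Sum>j<m. complex_of_real (e E j) * (complex_of_real (g u j) * F u x y))"
      by (simp add: a_def sum_distrib_right mult.assoc)
    also have "\<dots> = (\<Sum>j<m. complex_of_real (e E j) * (\<Sum>u<m. complex_of_real (g u j) * F u x y))"
      by (subst sum.swap) (simp add: sum_distrib_left)
    also have "\<dots> = (\<Sum>j<m. complex_of_real (e E j) * b j x y)" using recover by simp
    also have "\<dots> = E x y" using repA[OF that] by metis
    finally show ?thesis .
  qed
  have average: "(\<Sum>s\<in>S. P \<rho> s * g (s k) j) = Re (tr_prod d \<rho> (b j))"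
    if \<rho>: "\<rho> \<in> T" and j: "j < m" and k: "k < n" for \<rho> j k
  proof -
    \<comment> \<open>Constant value 1 outside slot \<open>k\<close> sums the outcomes there to the
      identity, leaving the marginal of copy \<open>k\<close>.\<close>
    define G where "G i u = (if i = k then g u j else 1)" for i u
    have G: "(\<lambda>x y. \<Sum>u<m. complex_of_real (G i u) * F u x y) = (if i = k then b j else identity d)" for i
      using recover[OF j] F(2) by (auto simp: G_def)
    have "(\<Prod>i<n. complex_of_real (G i (s i))) = complex_of_real (g (s k) j)" for s
    proof -
      have "(\<Prod>i<n. complex_of_real (G i (s i))) = (\<Prod>i<n. if i = k then complex_of_real (g (s k) j) else 1)"
        by (intro prod.cong) (auto simp: G_def)
      then show ?thesis using k by simp
    qed
    then have "slot_tr d n (\<Xi> \<rho>) (\<lambda>i. if i = k then b j else identity d)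
        = (\<Sum>s\<in>S. complex_of_real (g (s k) j) * slot_tr d n (\<Xi> \<rho>) (\<lambda>i. F (s i)))"
      using slot_tr_expand[of "{..<m}" d n "\<Xi> \<rho>" "\<lambda>i u. complex_of_real (G i u)" "\<lambda>_. F"]
      by (simp only: G S_def) simp
    then show ?thesis using marg[OF \<rho> k b(2)[OF j]]
      by (simp add: P_def mult.commute)
  qed
  have q_average: "(\<Sum>s\<in>S. P \<rho> s * q s j) = Re (tr_prod d \<rho> (b j))" if "\<rho> \<in> T" "j < m" for \<rho> j
  proof -
    have "(\<Sum>s\<in>S. P \<rho> s * q s j) = (\<Sum>k<n. \<Sum>s\<in>S. P \<rho> s * g (s k) j) / n"
      unfolding q_def by (subst sum.swap) (simp add: sum_distrib_left sum_divide_distrib)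
    also have "\<dots> = Re (tr_prod d \<rho> (b j))" using average[OF that] n(1) by simp
    finally show ?thesis .
  qed
  have weight: "(\<Sum>s\<in>Bad. P \<rho> s) \<le> card B0 * exp (- real n * \<kappa>)" if \<rho>: "\<rho> \<in> T" for \<rho>
  proof -
    have "(\<Sum>s\<in>Bad. P \<rho> s) \<le> (\<Sum>E\<in>B0. \<Sum>s\<in>bad E. P \<rho> s)"
      unfolding Bad_def using B0 S(1) P[OF \<rho>] by (intro sum_UN_le) (auto simp: bad_def)
    also have "\<dots> \<le> (\<Sum>E\<in>B0. exp (- real n * \<kappa>))"
    proof (rule sum_mono)
      fix E assume E: "E \<in> B0"
      then have EA: "E \<in> A" using B0 by blast
      show "(\<Sum>s\<in>bad E. P \<rho> s) \<le> exp (- real n * \<kappa>)"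
        unfolding bad_def P_def \<kappa>_def S_def
        by (rule chernoff_bound[OF pos[OF \<rho>] norm[OF \<rho>] F EA aF[OF EA] aC[OF E] C1 \<eta>(1,2)])
    qed
    finally show ?thesis by simp
  qed
  have "separable_model r m (c ` T) (e ` B0) (\<lambda>i j. Re (tr_prod d (rb i) (b j))) \<delta> S (\<lambda>s i. P (rb i) s) q'"
    unfolding separable_model_def
  proof (intro conjI ballI allI impI)
    show "0 \<le> P (rb i) s" if "s \<in> S" "i < r" for s i using P rb that by blast
    show "0 \<le> (\<Sum>i<r. x i * P (rb i) s)" if s: "s \<in> S" and x: "x \<in> c ` T" for s x
    proof -
      obtain \<rho> where \<rho>: "\<rho> \<in> T" "x = c \<rho>" using x by blast
      have "P \<rho> s = (\<Sum>i<r. x i * P (rb i) s)" unfolding P_def \<rho>(2) lin[OF \<rho>(1)] by simp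
      then show ?thesis using P[OF \<rho>(1) s] by simp
    qed
    show "q' s 0 = 1" for s
      using b(1) d n(1) g(2) by (simp add: q'_def q_def identity_def)
    show "- \<delta> \<le> (\<Sum>j<m. x j * q' s j)" if s: "s \<in> S" and x: "x \<in> e ` B0" for s x
    proof -
      obtain E where E: "E \<in> B0" "x = e E" using x by blast
      then have EA: "E \<in> A" using B0 by blast
      show ?thesis
      proof (cases "s \<in> Bad")
        case True
        have "E 0 0 = (\<Sum>j<m. complex_of_real (e E j) * b j 0 0)" using repA[OF EA] by metis
        then have "(\<Sum>j<m. x j * q' s j) = Re (E 0 0)" using True by (simp add: E(2) q'_def)
        then show ?thesis using psd_diag[OF _ d, of E] effect[OF EA] \<delta>
          by (auto simp: is_effect_def less_eq_complex_def)
      next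
        case False
        have "(\<Sum>j<m. x j * q' s j) = (\<Sum>k<n. a E (s k)) / n"
          unfolding a_def using False
          by (subst sum.swap) (simp add: E(2) q'_def q_def sum_distrib_left sum_divide_distrib)
        moreover have "- \<eta> * n \<le> (\<Sum>k<n. a E (s k))"
          using False s E(1) by (auto simp: Bad_def bad_def not_less)
        then have "- \<eta> \<le> (\<Sum>k<n. a E (s k)) / n" using n(1) by (simp add: le_divide_eq)
        ultimately show ?thesis using \<eta>(3) by linarith
      qed
    qed
    show "\<bar>(\<Sum>s\<in>S. P (rb i) s * q' s j) - Re (tr_prod d (rb i) (b j))\<bar> \<le> \<delta>" if i: "i < r" and j: "j < m" for i j
    proof -
      note \<rho> = rb[OF i]
      have "(\<Sum>s\<in>S. P (rb i) s * q' s j) - Re (tr_prod d (rb i) (b j))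
          = (\<Sum>s\<in>S. P (rb i) s * (q' s j - q s j))"
        by (simp add: q_average[OF \<rho> j, symmetric] right_diff_distrib sum_subtractf)
      also have "\<dots> = (\<Sum>s\<in>Bad. P (rb i) s * (q' s j - q s j))"
        using S(1) Bad by (intro sum.mono_neutral_right) (auto simp: q'_def)
      also have "\<bar>\<dots>\<bar> \<le> (\<Sum>s\<in>Bad. \<bar>P (rb i) s * (q' s j - q s j)\<bar>)" by (rule sum_abs)
      also have "\<dots> \<le> (\<Sum>s\<in>Bad. P (rb i) s * real m)"
      proof (rule sum_mono)
        fix s assume "s \<in> Bad"
        then have "0 \<le> P (rb i) s" using P[OF \<rho>] Bad by blast
        moreover have "\<bar>q' s j - q s j\<bar> \<le> real m" using q[of s j] q'[OF j, of s] by linarith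
        ultimately show "\<bar>P (rb i) s * (q' s j - q s j)\<bar> \<le> P (rb i) s * real m"
          by (simp add: abs_mult mult_left_mono)
      qed
      also have "\<dots> = real m * (\<Sum>s\<in>Bad. P (rb i) s)" by (simp add: sum_distrib_left mult.commute)
      also have "\<dots> \<le> real m * (card B0 * exp (- real n * \<kappa>))"
        using weight[OF \<rho>] by (intro mult_left_mono) auto
      also have "\<dots> \<le> \<delta>" using n(2) by (simp add: mult.assoc)
      finally show ?thesis .
    qed
  qed
  then show ?thesis using S q' by blast
qed

text \<open>Pairing the arrays of an exact coordinate model with the dual bases \<open>RD\<close>
  and \<open>D\<close> gives operators whose traces against states and effects are the sums
  controlled by the model.\<close>

lemma pseudo_broadcastable_imp_noncontextual:
  assumes pb: "\<And>n. n \<ge> 1 \<Longrightarrow> pseudo_broadcastable d n T A"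
    and states: "\<And>\<rho>. \<rho> \<in> T \<Longrightarrow> is_state d \<rho>"
  shows "mp_noncontextual d T A"
proof (cases "T = {}")
  case True
  then show ?thesis unfolding mp_noncontextual_def by (intro exI[of _ 0]) auto
next
  case False
  then obtain \<rho>0 where \<rho>0: "\<rho>0 \<in> T" by blast
  have psd: "psd d \<rho>" and tr1: "mtrace d \<rho> = 1" if "\<rho> \<in> T" for \<rho>
    using states[OF that] by (auto simp: is_state_def)
  \<comment> \<open>A nonzero diagonal entry, which exists by trace 1, gives \<open>d > 0\<close>
    and seeds the dual basis of the states.\<close>
  obtain z where z: "z < d" "\<rho>0 z z \<noteq> 0"
  proof -
    have "\<exists>z\<in>{..<d}. \<rho>0 z z \<noteq> 0"
    proof (rule ccontr)
      assume "\<not> ?thesis"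
      then have "mtrace d \<rho>0 = 0" by (simp add: mtrace_def)
      then show False using tr1[OF \<rho>0] by simp
    qed
    then show ?thesis using that by blast
  qed
  then have d: "0 < d" by simp
  obtain r :: nat and rb RD and c :: "cmat \<Rightarrow> nat \<Rightarrow> real" where
      rb: "\<And>i. i < r \<Longrightarrow> rb i \<in> T" and RD: "\<And>i. supported d (RD i)"
      and cT: "\<And>\<rho> i. \<rho> \<in> T \<Longrightarrow> i < r \<Longrightarrow> tr_prod d \<rho> (RD i) = complex_of_real (c \<rho> i)"
      and repT: "\<And>\<rho>. \<rho> \<in> T \<Longrightarrow> \<rho> = (\<lambda>x y. \<Sum>i<r. complex_of_real (c \<rho> i) * rb i x y)"
    by (rule psd_dual_basis[OF psd \<rho>0 z(2)], assumption+) (rule that)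
  obtain m :: nat and b D F and e :: "cmat \<Rightarrow> nat \<Rightarrow> real" and g :: "nat \<Rightarrow> nat \<Rightarrow> real"
    where m: "0 < m" and b: "b 0 = identity d" "\<And>j. j < m \<Longrightarrow> b j \<in> A" and D: "\<And>j. supported d (D j)"
    and dual: "\<And>j k. j < m \<Longrightarrow> k < m \<Longrightarrow> e (b j) k = (if j = k then 1 else 0)"
    and eA: "\<And>E j. E \<in> A \<Longrightarrow> j < m \<Longrightarrow> tr_prod d E (D j) = complex_of_real (e E j)"
    and repA: "\<And>E. E \<in> A \<Longrightarrow> E = (\<lambda>x y. \<Sum>j<m. complex_of_real (e E j) * b j x y)"
    and F: "\<And>u. u < m \<Longrightarrow> F u \<in> A" "\<And>x y. (\<Sum>u<m. F u x y) = identity d x y"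
    and recover: "\<And>j x y. j < m \<Longrightarrow> (\<Sum>u<m. complex_of_real (g u j) * F u x y) = b j x y"
    and g: "\<And>u j. 0 \<le> g u j \<and> g u j \<le> real m" "\<And>u. g u 0 = 1"
    by (rule informationally_complete_measurement[OF d]) (rule that)
  define M where "M i j = Re (tr_prod d (rb i) (b j))" for i j
  define N where "N = r * m"
  have M0: "M i 0 = 1" if "i < r" for i
    using tr1[OF rb[OF that]] by (simp add: M_def b(1) tr_prod_identity)
  have approx: "\<exists>(S::(nat \<Rightarrow> nat) set) p q. finite S \<and> S \<noteq> {} \<and>
      separable_model r m (c ` T) B M \<delta> S p q \<and> (\<forall>s\<in>S. \<forall>j<m. 0 \<le> q s j \<and> q s j \<le> real m)"
    if B: "finite B" "B \<subseteq> e ` A" and \<delta>: "0 < \<delta>" for B \<delta>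
  proof -
    obtain B0 where B0: "finite B0" "B0 \<subseteq> A" "B = e ` B0"
      using finite_subset_image[OF B] by blast
    show ?thesis unfolding B0(3) M_def
      by (rule approximate_separable_model[OF pb states d rb repT m b repA F recover g B0(1,2) \<delta>])
  qed
  have ne: "e ` A \<noteq> {}" using identity_in by blast
  obtain p q where pq: "separable_model r m (c ` T) (e ` A) M 0 {..<N} p q"
    unfolding N_def by (rule exact_separable_model[OF m M0 ne approx])
  have cp: "0 \<le> (\<Sum>i<r. c \<rho> i * p l i)" if "\<rho> \<in> T" "l < N" for \<rho> l
    using pq that unfolding separable_model_def by blast
  have q0: "q l 0 = 1" if "l < N" for l using pq that unfolding separable_model_def by blast
  have eq: "0 \<le> (\<Sum>j<m. e E j * q l j)" if "E \<in> A" "l < N" for E l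
    using pq that unfolding separable_model_def by fastforce
  have Mpq: "M i j = (\<Sum>l<N. p l i * q l j)" if "i < r" "j < m" for i j
    using pq that unfolding separable_model_def by fastforce
  define G where "G l = (\<lambda>x y. \<Sum>i<r. complex_of_real (p l i) * RD i x y)" for l
  define \<sigma> where "\<sigma> l = (\<lambda>x y. \<Sum>j<m. complex_of_real (q l j) * D j x y)" for l
  have trG: "tr_prod d \<rho> (G l) = complex_of_real (\<Sum>i<r. c \<rho> i * p l i)" if "\<rho> \<in> T" for \<rho> l
    unfolding G_def tr_prod_sum_right using cT[OF that] by (simp add: mult.commute)
  have tr\<sigma>: "tr_prod d (\<sigma> l) E = complex_of_real (\<Sum>j<m. e E j * q l j)" if "E \<in> A" for E l
    unfolding \<sigma>_def tr_prod_sum_left using eA[OF that] by (simp add: tr_prod_commute[of d "D _"] mult.commute)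
  have tr\<sigma>1: "tr_prod d (\<sigma> l) (identity d) = 1" if "l < N" for l
  proof -
    have "(\<Sum>j<m. e (identity d) j * q l j) = (\<Sum>j<m. if j = 0 then q l 0 else 0)"
      using dual[OF m] by (intro sum.cong) (auto simp: b(1)[symmetric])
    then show ?thesis using q0[OF that] m by (simp add: tr\<sigma>[OF identity_in])
  qed
  \<comment> \<open>\<open>M\<close> records only real parts. That \<open>tr[\<rho> E]\<close> is
    real follows from the broadcast to a single copy: it equals a nonnegative slot
    functional.\<close>
  have trM: "tr_prod d (rb i) (b j) = complex_of_real (M i j)" if i: "i < r" and j: "j < m" for i j
  proof -
    obtain \<Xi> where pos: "\<And>\<rho>. \<rho> \<in> T \<Longrightarrow> positive_on 1 (\<Xi> \<rho>)"
      and marg: "\<And>\<rho> k E. \<rho> \<in> T \<Longrightarrow> k < 1 \<Longrightarrow> E \<in> A \<Longrightarrow>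
        slot_tr d 1 (\<Xi> \<rho>) (\<lambda>i. if i = k then E else identity d) = tr_prod d \<rho> E"
      by (rule pseudo_broadcastable_functional[OF pb[OF order_refl] states rb repT], assumption+) (rule that)
    have "0 \<le> slot_tr d 1 (\<Xi> (rb i)) (\<lambda>k. if k = 0 then b j else identity d)"
      using pos[OF rb[OF i]] b(2)[OF j] by (simp add: positive_on_def)
    also have "\<dots> = tr_prod d (rb i) (b j)"
      by (rule marg[OF rb[OF i] _ b(2)[OF j]]) simp
    finally have "0 \<le> tr_prod d (rb i) (b j)" .
    then show ?thesis by (simp add: M_def complex_eq_iff less_eq_complex_def)
  qed
  have dec: "tr_prod d \<rho> E = (\<Sum>l<N. tr_prod d \<rho> (G l) * tr_prod d (\<sigma> l) E)" if \<rho>: "\<rho> \<in> T" and E: "E \<in> A" for \<rho> E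
  proof -
    have "tr_prod d \<rho> E = tr_prod d (\<lambda>x y. \<Sum>i<r. complex_of_real (c \<rho> i) * rb i x y)
        (\<lambda>x y. \<Sum>j<m. complex_of_real (e E j) * b j x y)"
      by (rule arg_cong2[where f = "tr_prod d", OF repT[OF \<rho>] repA[OF E]])
    also have "\<dots> = (\<Sum>i<r. \<Sum>j<m. complex_of_real (c \<rho> i * e E j * M i j))"
      unfolding tr_prod_sum_left tr_prod_sum_right sum_distrib_left
      by (intro sum.cong) (auto simp: trM)
    also have "\<dots> = complex_of_real (\<Sum>i<r. \<Sum>j<m. \<Sum>l<N. (c \<rho> i * p l i) * (e E j * q l j))"
      by (simp add: Mpq sum_distrib_left mult_ac)
    also have "(\<Sum>i<r. \<Sum>j<m. \<Sum>l<N. (c \<rho> i * p l i) * (e E j * q l j))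
        = (\<Sum>i<r. \<Sum>l<N. \<Sum>j<m. (c \<rho> i * p l i) * (e E j * q l j))"
      by (intro sum.cong refl sum.swap)
    also have "\<dots> = (\<Sum>l<N. (\<Sum>i<r. c \<rho> i * p l i) * (\<Sum>j<m. e E j * q l j))"
      by (subst sum.swap) (simp add: sum_product)
    finally show ?thesis by (simp add: trG[OF \<rho>] tr\<sigma>[OF E])
  qed
  have supG: "supported d (G l)" "supported d (\<sigma> l)" for l
    using RD D by (auto simp: supported_def G_def \<sigma>_def)
  show ?thesis
    unfolding mp_noncontextual_def
  proof (rule exI[of _ N], rule exI[of _ G], rule exI[of _ \<sigma>], intro conjI allI impI ballI)
    show "0 \<le> tr_prod d \<rho> (G l)" if "\<rho> \<in> T" "l < N" for \<rho> l
      using cp[OF that] by (simp add: trG[OF that(1)] less_eq_complex_def)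
    \<comment> \<open>Normalisation is the decomposition evaluated at the unit effect, where each
      \<open>\<sigma> l\<close> gives 1.\<close>
    show "(\<Sum>l<N. tr_prod d \<rho> (G l)) = 1" if "\<rho> \<in> T" for \<rho>
      using dec[OF that identity_in] tr1[OF that] by (simp add: tr\<sigma>1 tr_prod_identity[of d \<rho>])
    show "0 \<le> tr_prod d (\<sigma> l) E" if "l < N" "E \<in> A" for l E
      using eq[OF that(2,1)] by (simp add: tr\<sigma>[OF that(2)] less_eq_complex_def)
    show "mtrace d (\<sigma> l) = 1" if "l < N" for l
      using tr\<sigma>1[OF that] by (simp add: tr_prod_identity)
  qed (use supG dec in auto)
qed

end

theorem theorem3:
  fixes d :: nat and T A :: "cmat set"
  assumes "\<forall>\<rho>\<in>T. is_state d \<rho>"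
    and "convex_mats T"
    and "\<forall>E\<in>A. is_effect d E"
    and "convex_mats A"
    and "identity d \<in> A"
    and "\<forall>E\<in>A. (\<lambda>i j. identity d i j - E i j) \<in> A"
  shows "mp_noncontextual d T A \<longleftrightarrow> (\<forall>n\<ge>1. pseudo_broadcastable d n T A)"
proof -
  interpret effect_set d A
    using assms by unfold_locales auto
  show ?thesis
    using noncontextual_imp_pseudo_broadcastable[of d T A] pseudo_broadcastable_imp_noncontextual[of T] assms(1)
    by blast
qed

end
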